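(* Let $r\ge 1$, let $M_r$ be the free metabelian group of rank $r$, and let $l\in\mathbb{N}$. Every finitely generated $l$-verbally closed subgroup $H$ of $M_r$ with $r_{ab}(H)=l+1$ is a retract of $M_r$.
   Context: $M_r=F_r/F_r''$ is the free group of rank $r$ in the variety of metabelian groups (solvable of derived length at most $2$), $F_r$ the free group of rank $r$. For a group $G$ with derived subgroup $G'$ and a finitely generated subgroup $H\le G$, $r_{ab}(H)$ is the minimal number of generators of $HG'/G'$. For $l\in\mathbb N$, a subgroup $H\le G$ is $l$-verbally closed in $G$ if for every $n$, every group words $w_1,\dots,w_l$ in variables $x_1,\dots,x_n$ (without constants) and every $h_1,\dots,h_l\in H$, if the system $w_i(x_1,\dots,x_n)=h_i$ ($i=1,\dots,l$) has a solution in $G$, then it has a solution in $H$. A subgroup $H\le G$ is a retract of $G$ if there is an endomorphism $\rho:G\to G$ with $\rho(G)\subseteq H$ that is the identity on $H$. *)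

theory Defs
  imports "HOL-Algebra.Algebra"
begin

text \<open>A letter is (b, i): generator x_i if b = True, its inverse if b = False.\<close>

definition cancel_step :: "bool \<times> nat \<Rightarrow> (bool \<times> nat) list \<Rightarrow> (bool \<times> nat) list" where
  "cancel_step a acc = (case acc of [] \<Rightarrow> [a]
     | b # rest \<Rightarrow> (if fst b \<noteq> fst a \<and> snd b = snd a then rest else a # acc))"

definition free_reduce :: "(bool \<times> nat) list \<Rightarrow> (bool \<times> nat) list" where
  "free_reduce xs = foldr cancel_step xs []"

definition freely_reduced :: "(bool \<times> nat) list \<Rightarrow> bool" where
  "freely_reduced xs \<longleftrightarrow>
     (\<forall>i. Suc i < length xs \<longrightarrow> \<not> (fst (xs ! i) \<noteq> fst (xs ! Suc i) \<and> snd (xs ! i) = snd (xs ! Suc i)))"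

definition free_group :: "nat \<Rightarrow> (bool \<times> nat) list monoid" where
  "free_group r = \<lparr> carrier = {xs. freely_reduced xs \<and> (\<forall>a \<in> set xs. snd a < r)},
                    monoid.mult = (\<lambda>xs ys. free_reduce (xs @ ys)),
                    monoid.one = [] \<rparr>"

definition free_metabelian :: "nat \<Rightarrow> (bool \<times> nat) list set monoid" where
  "free_metabelian r =
     free_group r Mod derived (free_group r) (derived (free_group r) (carrier (free_group r)))"

datatype gword = GVar nat | GOne | GMul gword gword | GInv gword

fun gvars :: "gword \<Rightarrow> nat set" where
  "gvars (GVar i) = {i}"
| "gvars GOne = {}"
| "gvars (GMul u v) = gvars u \<union> gvars v"
| "gvars (GInv u) = gvars u"

fun word_eval :: "('a, 'b) monoid_scheme \<Rightarrow> (nat \<Rightarrow> 'a) \<Rightarrow> gword \<Rightarrow> 'a" where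
  "word_eval G x (GVar i) = x i"
| "word_eval G x GOne = \<one>\<^bsub>G\<^esub>"
| "word_eval G x (GMul u v) = word_eval G x u \<otimes>\<^bsub>G\<^esub> word_eval G x v"
| "word_eval G x (GInv u) = inv\<^bsub>G\<^esub> (word_eval G x u)"

definition l_verbally_closed :: "nat \<Rightarrow> ('a, 'b) monoid_scheme \<Rightarrow> 'a set \<Rightarrow> bool" where
  "l_verbally_closed l G H \<longleftrightarrow>
     (\<forall>n (w :: nat \<Rightarrow> gword) (h :: nat \<Rightarrow> 'a).
        (\<forall>i < l. gvars (w i) \<subseteq> {..<n} \<and> h i \<in> H) \<longrightarrow>
        (\<exists>x. x ` {..<n} \<subseteq> carrier G \<and> (\<forall>i < l. word_eval G x (w i) = h i)) \<longrightarrow>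
        (\<exists>x. x ` {..<n} \<subseteq> H \<and> (\<forall>i < l. word_eval G x (w i) = h i)))"

definition is_retract :: "('a, 'b) monoid_scheme \<Rightarrow> 'a set \<Rightarrow> bool" where
  "is_retract G H \<longleftrightarrow>
     (\<exists>\<rho> \<in> hom G G. \<rho> ` carrier G \<subseteq> H \<and> (\<forall>h \<in> H. \<rho> h = h))"

definition fin_gen_subgroup :: "('a, 'b) monoid_scheme \<Rightarrow> 'a set \<Rightarrow> bool" where
  "fin_gen_subgroup G H \<longleftrightarrow> subgroup H G \<and>
     (\<exists>S. finite S \<and> S \<subseteq> carrier G \<and> generate G S = H)"

definition r_ab :: "('a, 'b) monoid_scheme \<Rightarrow> 'a set \<Rightarrow> nat" where
  "r_ab G H = (let D = derived G (carrier G);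
                   Q = G Mod D;
                   HQ = (\<lambda>h. D #>\<^bsub>G\<^esub> h) ` H
               in LEAST k. \<exists>S. finite S \<and> card S = k \<and> S \<subseteq> carrier Q \<and> generate Q S = HQ)"

end

theory Submission
  imports Defs "HOL-Library.Poly_Mapping" "HOL-Computational_Algebra.Polynomial"
begin

text \<open>
  Any \<open>k\<^sub>1, \<dots>, k\<^sub>l \<in> H\<close> are fixed by some endomorphism \<open>\<rho>\<close> of \<open>M = M\<^sub>r\<close> with image in \<open>H\<close>: write them as
  words in the free generators and solve the resulting system in \<open>H\<close>. With constant \<open>k\<^sub>i\<close> this gives
  \<open>H \<inter> M' = H'\<close>.

  Let \<open>h\<^sub>0, \<dots>, h\<^sub>l\<close> be a basis of \<open>H\<close> modulo \<open>M'\<close>, with images \<open>a\<^sub>i\<close> in \<open>M/M'\<close>. Regarding \<open>M'\<close> as a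
  module over the Laurent polynomials \<open>\<int>[M/M']\<close>, take \<open>k\<^sub>i = (\<Prod>\<^sub>j (1 - a\<^sub>j))\<^sup>N [h\<^sub>0, h\<^sub>i]\<close> for \<open>1 \<le> i \<le> l\<close>.
  By the Magnus embedding \<open>M'\<close> is torsion-free, and comparing the widths of Newton polytopes for large
  \<open>N\<close> shows that a \<open>\<rho>\<close> fixing \<open>k\<^sub>1\<close> permutes the \<open>\<plusminus>a\<^sub>i\<close>. So a power \<open>\<sigma>\<close> of \<open>\<rho>\<close> is the identity on \<open>H\<close>
  modulo \<open>M'\<close>, and still fixes every \<open>k\<^sub>i\<close>, hence every \<open>[h\<^sub>0, h\<^sub>i]\<close>.

  The difference \<open>\<delta>\<close> of the Fox derivatives of \<open>\<sigma> g\<close> and \<open>g\<close> is a crossed homomorphism on \<open>H\<close>; after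
  multiplying by \<open>1 - a\<^sub>0\<close> and subtracting a principal one it vanishes on all \<open>h\<^sub>i\<close>. As
  \<open>H = \<langle>h\<^sub>0, \<dots>, h\<^sub>l\<rangle> H'\<close>, its values lie in all powers of the augmentation ideal, so they are 0.
  Thus \<open>\<sigma>\<close> is the identity both on \<open>H \<inter> M'\<close> and modulo it, so it restricts to an automorphism of \<open>H\<close>,
  and composing \<open>\<sigma>\<close> with the inverse of that automorphism gives the retraction.
\<close>

section \<open>Laurent polynomials\<close>

text \<open>The additive group of \<open>int poly\<close> serves as the free abelian group on \<open>x\<^sub>0, x\<^sub>1, \<dots>\<close>, with
  \<open>x\<^sub>i\<close> encoded as \<open>monom 1 i\<close>; \<open>laurent\<close> is its integral group ring.\<close>

type_synonym laurent = "int poly \<Rightarrow>\<^sub>0 int"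

abbreviation lookup :: "('a \<Rightarrow>\<^sub>0 'b::zero) \<Rightarrow> 'a \<Rightarrow> 'b" where
  "lookup \<equiv> Poly_Mapping.lookup"

abbreviation keys :: "('a \<Rightarrow>\<^sub>0 'b::zero) \<Rightarrow> 'a set" where
  "keys \<equiv> Poly_Mapping.keys"

abbreviation mon :: "int poly \<Rightarrow> laurent" where
  "mon a \<equiv> Poly_Mapping.single a 1"

text \<open>As an additive group \<open>laurent\<close> is free abelian on the monomials, so a
  property stable under differences needs checking only on \<open>mon a\<close>.\<close>

lemma laurent_induct [case_names zero mon diff]:
  fixes u :: laurent
  assumes "P 0" "\<And>a. P (mon a)" "\<And>u v. P u \<Longrightarrow> P v \<Longrightarrow> P (u - v)"
  shows "P u"
  using frag_induction[of u UNIV P] assms by auto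

lemma mon_mult: "mon a * mon b = mon (a + b)"
  by (simp add: mult_single)

lemma mon_zero: "mon 0 = 1"
  by simp

lemma lookup_mon_mult: "lookup (mon a * u) b = lookup u (b - a)"
proof (induction u rule: laurent_induct)
  case (mon c)
  then show ?case
    by (auto simp: mon_mult lookup_single when_def algebra_simps)
qed (auto simp: right_diff_distrib lookup_minus)

lemma lookup_mult_keys:
  fixes u v :: laurent
  shows "lookup (u * v) k = (\<Sum>a\<in>keys u. lookup u a * lookup v (k - a))"
proof -
  \<comment> \<open>Summing over any finite superset of the support makes the claim additive in
    \<open>u\<close>; the supports of \<open>x\<close>, \<open>y\<close> and \<open>x - y\<close>
    differ.\<close>
  have *: "lookup (u * v) k = (\<Sum>a\<in>S. lookup u a * lookup v (k - a))"
    if "finite S" "keys u \<subseteq> S" for S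
    using that
  proof (induction u arbitrary: S rule: laurent_induct)
    case (mon c)
    then have "(\<Sum>a\<in>S. lookup (mon c) a * lookup v (k - a)) = (\<Sum>a\<in>{c}. lookup v (k - c))"
      by (intro sum.mono_neutral_cong_right) (auto simp: lookup_single when_def)
    then show ?case by (simp add: lookup_mon_mult)
  next
    case (diff x y)
    let ?T = "S \<union> keys x \<union> keys y"
    have "finite ?T" using diff by auto
    have "lookup ((x - y) * v) k = (\<Sum>a\<in>?T. lookup (x - y) a * lookup v (k - a))"
      using diff(1)[OF \<open>finite ?T\<close>] diff(2)[OF \<open>finite ?T\<close>]
      by (simp add: left_diff_distrib lookup_minus sum_subtractf Un_upper1 le_supI1 le_supI2)
    also have "\<dots> = (\<Sum>a\<in>S. lookup (x - y) a * lookup v (k - a))"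
    proof (intro sum.mono_neutral_right ballI)
      fix a assume a: "a \<in> ?T - S"
      then have "a \<notin> keys (x - y)" using diff by blast
      then show "lookup (x - y) a * lookup v (k - a) = 0"
        by (simp add: in_keys_iff)
    qed (use \<open>finite ?T\<close> in auto)
    finally show ?case .
  qed simp
  then show ?thesis by simp
qed

text \<open>Multiplication by \<open>1 - mon b\<close> raises the number of vanishing moments, so moments detect
  powers of the augmentation ideal. Exponents can be multiplied because they are polynomials.\<close>

definition moment :: "nat \<Rightarrow> laurent \<Rightarrow> int poly" where
  "moment k u = (\<Sum>a\<in>keys u. of_int (lookup u a) * a ^ k)"

lemma moment_superset:
  assumes "finite S" "keys u \<subseteq> S"
  shows "moment k u = (\<Sum>a\<in>S. of_int (lookup u a) * a ^ k)"
  unfolding moment_def using assms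
  by (intro sum.mono_neutral_left) (auto simp: in_keys_iff)

lemma moment_zero [simp]: "moment k 0 = 0"
  by (simp add: moment_def)

lemma moment_add: "moment k (u + v) = moment k u + moment k v"
proof -
  let ?S = "keys u \<union> keys v"
  have "keys (u + v) \<subseteq> ?S" by (rule keys_add)
  then show ?thesis
    by (simp add: moment_superset[of ?S] lookup_add sum.distrib algebra_simps)
qed

lemma moment_uminus: "moment k (- u) = - moment k u"
  by (simp add: moment_def sum_negf)

lemma moment_diff: "moment k (u - v) = moment k u - moment k v"
  using moment_add[of k u "- v"] by (simp add: moment_uminus)

lemma moment_mon: "moment k (mon a) = a ^ k"
  by (simp add: moment_def)

text \<open>Shifting exponents by \<open>b\<close> turns \<open>a ^ k\<close> into
  \<open>(a + b) ^ k\<close>, which the binomial theorem expands; both sides are additive in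
  \<open>u\<close>.\<close>

lemma moment_mon_mult:
  "moment k (mon b * u) = (\<Sum>j\<le>k. of_nat (k choose j) * b ^ (k - j) * moment j u)"
proof (induction u rule: laurent_induct)
  case (mon a)
  have "(a + b) ^ k = (\<Sum>j\<le>k. of_nat (k choose j) * a ^ j * b ^ (k - j))"
    by (rule binomial_ring)
  then show ?case by (simp add: mon_mult moment_mon add.commute mult_ac)
qed (auto simp: right_diff_distrib moment_diff sum_subtractf)

definition vanishes :: "nat \<Rightarrow> laurent \<Rightarrow> bool" where
  "vanishes k u \<longleftrightarrow> (\<forall>j<k. moment j u = 0)"

lemma vanishes_0 [simp]: "vanishes 0 u"
  by (simp add: vanishes_def)

lemma vanishes_zero [simp]: "vanishes k 0"
  by (simp add: vanishes_def)

lemma vanishes_add: "vanishes k u \<Longrightarrow> vanishes k v \<Longrightarrow> vanishes k (u + v)"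
  by (simp add: vanishes_def moment_add)

lemma vanishes_uminus: "vanishes k u \<Longrightarrow> vanishes k (- u)"
  by (simp add: vanishes_def moment_uminus)

lemma vanishes_diff: "vanishes k u \<Longrightarrow> vanishes k v \<Longrightarrow> vanishes k (u - v)"
  by (simp add: vanishes_def moment_diff)

lemma vanishes_mon_mult: "vanishes k u \<Longrightarrow> vanishes k (mon b * u)"
  by (simp add: vanishes_def moment_mon_mult)

text \<open>In the binomial expansion of the \<open>j\<close>-th moment of \<open>mon b * u\<close>
  with \<open>j \<le> k\<close>, the moments of order below \<open>j\<close> vanish and the top
  coefficient is 1. So \<open>u\<close> and \<open>mon b * u\<close> have the same
  \<open>j\<close>-th moment.\<close>

lemma vanishes_Suc_one_minus_mon:
  assumes "vanishes k u"
  shows "vanishes (Suc k) ((1 - mon b) * u)"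
  unfolding vanishes_def
proof (intro allI impI)
  fix j assume "j < Suc k"
  have "moment j (mon b * u) = (\<Sum>i\<in>{..j}. if i = j then moment j u else 0)"
    unfolding moment_mon_mult using assms \<open>j < Suc k\<close>
    by (intro sum.cong) (auto simp: vanishes_def)
  also have "\<dots> = moment j u" by simp
  finally show "moment j ((1 - mon b) * u) = 0"
    by (simp add: left_diff_distrib moment_diff)
qed

text \<open>A weighted power sum over finitely many exponents that vanishes in every degree still
  vanishes with \<open>x ^ k\<close> replaced by any polynomial in \<open>x\<close>. The polynomial
  with roots at all exponents but \<open>a\<close> isolates the coefficient at
  \<open>a\<close>.\<close>

lemma vanishes_all_imp_zero:
  assumes "\<And>k. vanishes k u"
  shows "u = 0"
proof (rule ccontr)
  assume "u \<noteq> 0"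
  then obtain a where a: "a \<in> keys u" using keys_eq_empty by blast
  have m: "(\<Sum>x\<in>keys u. of_int (lookup u x) * x ^ k) = 0" for k
    using assms[of "Suc k"] by (simp add: vanishes_def moment_def)
  have p: "(\<Sum>x\<in>keys u. of_int (lookup u x) * poly q x) = 0" for q :: "int poly poly"
  proof -
    have "(\<Sum>x\<in>keys u. of_int (lookup u x) * poly q x)
        = (\<Sum>i\<le>Polynomial.degree q. Polynomial.coeff q i * (\<Sum>x\<in>keys u. of_int (lookup u x) * x ^ i))"
      unfolding poly_altdef sum_distrib_left
      by (subst sum.swap) (simp add: mult_ac)
    then show ?thesis by (simp add: m)
  qed
  define q where "q = (\<Prod>b\<in>keys u - {a}. [:- b, 1:])"
  have q: "poly q x = (\<Prod>b\<in>keys u - {a}. x - b)" for x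
    by (simp add: q_def poly_prod)
  have "(\<Sum>x\<in>keys u. of_int (lookup u x) * poly q x)
      = (\<Sum>x\<in>{a}. of_int (lookup u x) * poly q x)"
  proof (intro sum.mono_neutral_right ballI)
    fix x assume "x \<in> keys u - {a}"
    then have "poly q x = 0" unfolding q by (intro prod_zero) auto
    then show "of_int (lookup u x) * poly q x = 0" by simp
  qed (use a in auto)
  moreover have "poly q a \<noteq> 0" unfolding q by (subst prod_zero_iff) auto
  ultimately show False using p[of q] a by (simp add: in_keys_iff)
qed

section \<open>Degrees along additive functionals and widths of Newton polytopes\<close>

definition top_degree :: "(int poly \<Rightarrow> int) \<Rightarrow> laurent \<Rightarrow> int" where
  "top_degree f u = Max (f ` keys u)"

text \<open>\<open>f\<close> may be maximal at several exponents; ties are broken by the linear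
  order on \<open>int poly\<close>. The sum of the two leading exponents so chosen arises in only
  one way in the product, so its coefficient cannot cancel.\<close>

lemma top_degree_mult:
  assumes f: "\<And>x y. f (x + y) = f x + f y" and "u \<noteq> 0" "v \<noteq> 0"
  shows "top_degree f (u * v) = top_degree f u + top_degree f v"
proof -
  have lead: "\<exists>a\<in>keys w. (\<forall>x\<in>keys w. f x \<le> f a) \<and> (\<forall>x\<in>keys w. f x = f a \<longrightarrow> x \<le> a)"
    if "w \<noteq> 0" for w :: laurent
  proof -
    let ?m = "Max (f ` keys w)" and ?K = "{x \<in> keys w. f x = Max (f ` keys w)}"
    have ne: "keys w \<noteq> {}" using that by simp
    have "?m \<in> f ` keys w" using ne by (intro Max_in) auto
    then have "?K \<noteq> {}" by auto
    then have "Max ?K \<in> ?K" by (intro Max_in) auto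
    moreover have "x \<le> Max ?K" if "x \<in> ?K" for x using that by (intro Max_ge) auto
    moreover have "f x \<le> ?m" if "x \<in> keys w" for x using that by (intro Max_ge) auto
    ultimately show ?thesis by (intro bexI[of _ "Max ?K"]) auto
  qed
  obtain a where a: "a \<in> keys u" "\<And>x. x \<in> keys u \<Longrightarrow> f x \<le> f a"
      "\<And>x. x \<in> keys u \<Longrightarrow> f x = f a \<Longrightarrow> x \<le> a"
    using lead[OF \<open>u \<noteq> 0\<close>] by blast
  obtain b where b: "b \<in> keys v" "\<And>x. x \<in> keys v \<Longrightarrow> f x \<le> f b"
      "\<And>x. x \<in> keys v \<Longrightarrow> f x = f b \<Longrightarrow> x \<le> b"
    using lead[OF \<open>v \<noteq> 0\<close>] by blast
  have "lookup (u * v) (a + b) = (\<Sum>x\<in>{a}. lookup u x * lookup v (a + b - x))"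
    unfolding lookup_mult_keys
  proof (intro sum.mono_neutral_right ballI)
    fix x assume x: "x \<in> keys u - {a}"
    have "a + b - x \<notin> keys v"
    proof
      assume y: "a + b - x \<in> keys v"
      have "f (a + b - x) + f x = f a + f b" by (simp add: f[symmetric])
      moreover have "f x \<le> f a" using x a by blast
      moreover have "f (a + b - x) \<le> f b" using y b by blast
      ultimately have "f x = f a" "f (a + b - x) = f b" by linarith+
      then have "x \<le> a" "a + b - x \<le> b" using x y a b by blast+
      then show False using x by (simp add: algebra_simps)
    qed
    then show "lookup u x * lookup v (a + b - x) = 0" by (simp add: in_keys_iff)
  qed (use a in auto)
  then have ab: "a + b \<in> keys (u * v)"
    using a(1) b(1) by (simp add: in_keys_iff)
  have "f x \<le> f a + f b" if x: "x \<in> keys (u * v)" for x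
  proof -
    obtain y z where "y \<in> keys u" "z \<in> keys v" "x = y + z"
      using x keys_mult[of u v] by blast
    then show ?thesis using a(2)[of y] b(2)[of z] by (simp add: f)
  qed
  then have "Max (f ` keys (u * v)) = f a + f b"
    using ab by (intro Max_eqI) (auto simp: f[symmetric])
  moreover have "Max (f ` keys u) = f a" using a by (intro Max_eqI) auto
  moreover have "Max (f ` keys v) = f b" using b by (intro Max_eqI) auto
  ultimately show ?thesis by (simp add: top_degree_def)
qed

text \<open>Maximum minus minimum of \<open>f\<close> over the support: the width of the Newton
  polytope in direction \<open>f\<close>. Unlike \<open>top_degree\<close> it is never negative on
  nonzero elements.\<close>

definition width :: "(int poly \<Rightarrow> int) \<Rightarrow> laurent \<Rightarrow> int" where
  "width f u = top_degree f u + top_degree (\<lambda>x. - f x) u"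

lemma width_mult:
  assumes "\<And>x y. f (x + y) = f x + f y" and "u \<noteq> 0" "v \<noteq> 0"
  shows "width f (u * v) = width f u + width f v"
  unfolding width_def using assms
  by (simp add: top_degree_mult[where f = f] top_degree_mult[where f = "\<lambda>x. - f x"])

lemma width_nonneg:
  assumes "u \<noteq> 0"
  shows "0 \<le> width f u"
proof -
  obtain a where "a \<in> keys u" using assms keys_eq_empty by blast
  then have "f a \<le> top_degree f u" "- f a \<le> top_degree (\<lambda>x. - f x) u"
    unfolding top_degree_def by (auto intro!: Max_ge)
  then show ?thesis by (simp add: width_def)
qed

lemma one_minus_mon_eq_0_iff: "1 - mon a = 0 \<longleftrightarrow> a = 0"
  by (metis mon_zero right_minus_eq frag_of_eq)

lemma width_one_minus_mon:
  assumes f: "\<And>x y. f (x + y) = f x + f y" and "a \<noteq> 0"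
  shows "width f (1 - mon a) = \<bar>f a\<bar>"
proof -
  have "keys (1 - mon a) = {0, a}"
    using \<open>a \<noteq> 0\<close> by (auto simp: in_keys_iff lookup_minus lookup_one lookup_single when_def split: if_splits)
  moreover have "f 0 = 0" using f[of 0 0] by simp
  ultimately show ?thesis by (auto simp: width_def top_degree_def)
qed

lemma width_one:
  assumes f: "\<And>x y. f (x + y) = f x + f y"
  shows "width f 1 = 0"
  using width_mult[of f 1 1] f by simp

lemma width_power:
  assumes f: "\<And>x y. f (x + y) = f x + f y" and "u \<noteq> 0"
  shows "width f (u ^ n) = int n * width f u"
  by (induction n) (use assms in \<open>auto simp: width_one width_mult algebra_simps\<close>)

lemma width_prod:
  assumes f: "\<And>x y. f (x + y) = f x + f y" and "finite I" "\<And>i. i \<in> I \<Longrightarrow> u i \<noteq> 0"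
  shows "width f (\<Prod>i\<in>I. u i) = (\<Sum>i\<in>I. width f (u i))"
  using assms(2,3)
  by (induction I rule: finite_induct) (use f in \<open>auto simp: width_one width_mult\<close>)

section \<open>Integral independence\<close>

text \<open>\<open>of_int (c i)\<close> is a constant polynomial, so this is the additive subgroup
  generated by the \<open>a i\<close>, not an ideal of \<open>int poly\<close>.\<close>

definition lspan :: "(nat \<Rightarrow> int poly) \<Rightarrow> nat \<Rightarrow> int poly set" where
  "lspan a n = {x. \<exists>c :: nat \<Rightarrow> int. x = (\<Sum>i<n. of_int (c i) * a i)}"

text \<open>Integral linear independence, despite what the name may suggest.\<close>

definition lindep :: "(nat \<Rightarrow> int poly) \<Rightarrow> nat \<Rightarrow> bool" where
  "lindep a n \<longleftrightarrow> (\<forall>c :: nat \<Rightarrow> int. (\<Sum>i<n. of_int (c i) * a i) = 0 \<longrightarrow> (\<forall>i<n. c i = 0))"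

lemma lindepD:
  fixes c :: "nat \<Rightarrow> int"
  shows "lindep a n \<Longrightarrow> (\<Sum>i<n. of_int (c i) * a i) = 0 \<Longrightarrow> i < n \<Longrightarrow> c i = 0"
  by (simp add: lindep_def)

lemma lspan_zero: "0 \<in> lspan a n"
  unfolding lspan_def by (auto intro!: exI[of _ "\<lambda>_. 0"])

lemma lspan_base:
  assumes "i < n"
  shows "a i \<in> lspan a n"
proof -
  have "(\<Sum>j<n. of_int (if j = i then 1 else 0) * a j) = (\<Sum>j<n. if j = i then a j else 0)"
    by (intro sum.cong) auto
  also have "\<dots> = a i" using assms by simp
  finally show ?thesis unfolding lspan_def
    by (intro CollectI exI[of _ "\<lambda>j. if j = i then 1 else 0"]) simp
qed

lemma lspan_add:
  assumes "x \<in> lspan a n" "y \<in> lspan a n"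
  shows "x + y \<in> lspan a n"
proof -
  obtain c d :: "nat \<Rightarrow> int" where
    "x = (\<Sum>i<n. of_int (c i) * a i)" "y = (\<Sum>i<n. of_int (d i) * a i)"
    using assms by (auto simp: lspan_def)
  then have "x + y = (\<Sum>i<n. of_int (c i + d i) * a i)"
    by (simp add: algebra_simps sum.distrib)
  then show ?thesis unfolding lspan_def by (intro CollectI exI[of _ "\<lambda>i. c i + d i"])
qed

lemma lspan_scale:
  assumes "x \<in> lspan a n"
  shows "of_int k * x \<in> lspan a n"
proof -
  obtain c :: "nat \<Rightarrow> int" where "x = (\<Sum>i<n. of_int (c i) * a i)"
    using assms by (auto simp: lspan_def)
  then have "of_int k * x = (\<Sum>i<n. of_int (k * c i) * a i)"
    by (simp add: algebra_simps sum_distrib_left)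
  then show ?thesis unfolding lspan_def by (intro CollectI exI[of _ "\<lambda>i. k * c i"])
qed

lemma lspan_uminus: "x \<in> lspan a n \<Longrightarrow> - x \<in> lspan a n"
  using lspan_scale[of x a n "-1"] by simp

lemma lspan_trans:
  assumes "x \<in> lspan a n" "\<And>i. i < n \<Longrightarrow> a i \<in> lspan b m"
  shows "x \<in> lspan b m"
proof -
  obtain c :: "nat \<Rightarrow> int" where x: "x = (\<Sum>i<n. of_int (c i) * a i)"
    using assms by (auto simp: lspan_def)
  have "(\<Sum>i<k. of_int (c i) * a i) \<in> lspan b m" if "k \<le> n" for k
    using that by (induction k) (auto intro!: lspan_zero lspan_add lspan_scale assms(2))
  then show ?thesis by (simp add: x)
qed

lemma lindep_nonzero:
  assumes "lindep a n" "i < n"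
  shows "a i \<noteq> 0"
proof
  assume "a i = 0"
  then have "(\<Sum>j<n. of_int (if j = i then 1 else 0) * a j) = 0"
    by (intro sum.neutral) auto
  then show False
    using lindepD[OF assms(1) _ assms(2), of "\<lambda>j. if j = i then 1 else 0"] by simp
qed

text \<open>Euclidean descent on the coefficients: a nontrivial relation among \<open>n\<close> generators allows
  to get by with \<open>n - 1\<close> of them, because \<open>int poly\<close> is torsion-free.\<close>

lemma lspan_reduce:
  assumes "(\<Sum>i<n. of_int (c i) * a i) = 0" "\<exists>i<n. c i \<noteq> (0 :: int)"
  shows "\<exists>b. (\<forall>i<n - 1. b i \<in> lspan a n) \<and> (\<forall>i<n. a i \<in> lspan b (n - 1))"
  using assms
proof (induction "\<Sum>i<n. nat \<bar>c i\<bar>" arbitrary: a c rule: less_induct)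
  case less
  show ?case
  proof (cases "\<exists>i j. i < n \<and> j < n \<and> i \<noteq> j \<and> c i \<noteq> 0 \<and> c j \<noteq> 0 \<and> \<bar>c j\<bar> \<le> \<bar>c i\<bar>")
    case True
    then obtain i j where ij: "i < n" "j < n" "i \<noteq> j" "c i \<noteq> 0" "c j \<noteq> 0" "\<bar>c j\<bar> \<le> \<bar>c i\<bar>"
      by blast
    \<comment> \<open>\<open>c i * a i + c j * a j = (c i - s * c j) * a i + c j * (a j + s * a
      i)\<close>: the sign \<open>s\<close> shrinks the larger coefficient, and the change of
      \<open>a j\<close> keeps both the relation and the span.\<close>
    define s where "s = sgn (c i) * sgn (c j)"
    define a' where "a' = a(j := a j + of_int s * a i)"
    define c' where "c' = c(i := c i - s * c j)"
    have lt: "\<bar>c i - s * c j\<bar> < \<bar>c i\<bar>"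
      using ij by (auto simp: s_def sgn_if abs_if split: if_splits)
    have split: "(\<Sum>k<n. f k) = f i + f j + (\<Sum>k\<in>{..<n} - {i, j}. f k)" for f :: "nat \<Rightarrow> 'z::comm_monoid_add"
    proof -
      have "(\<Sum>k<n. f k) = (\<Sum>k\<in>{i, j}. f k) + (\<Sum>k\<in>{..<n} - {i, j}. f k)"
        using ij by (intro sum.subset_diff[of "{i, j}" "{..<n}", THEN trans]) (auto simp: add.commute)
      then show ?thesis using ij by (simp add: add.assoc)
    qed
    have "(\<Sum>k<n. nat \<bar>c' k\<bar>) < (\<Sum>k<n. nat \<bar>c k\<bar>)"
      using ij lt by (intro sum_strict_mono_ex1) (auto simp: c'_def intro!: bexI[of _ i])
    moreover have "(\<Sum>k<n. of_int (c' k) * a' k) = (\<Sum>k<n. of_int (c k) * a k)"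
      unfolding split using ij by (simp add: c'_def a'_def algebra_simps)
    moreover have "c' j \<noteq> 0" using ij by (simp add: c'_def)
    ultimately obtain b where b: "\<forall>k<n - 1. b k \<in> lspan a' n" "\<forall>k<n. a' k \<in> lspan b (n - 1)"
      using less(1)[of c' a'] less(2) ij(2) by auto
    have a': "a' k \<in> lspan a n" if "k < n" for k
      using that ij by (auto simp: a'_def intro!: lspan_add lspan_scale lspan_base)
    have "a k \<in> lspan b (n - 1)" if "k < n" for k
    proof (cases "k = j")
      case True
      have "a j = a' j + - (of_int s * a' i)" using ij by (simp add: a'_def)
      then show ?thesis
        unfolding True using b(2) ij by (metis lspan_add lspan_uminus lspan_scale)
    next
      case False
      then show ?thesis using b(2) that by (auto simp: a'_def dest: spec[of _ k])
    qed
    then show ?thesis using b(1) a' lspan_trans by blast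
  next
    case False
    \<comment> \<open>Only one coefficient is nonzero, so \<open>a i = 0\<close> as
      \<open>int poly\<close> has no torsion. Its slot is filled with the last generator.\<close>
    obtain i where i: "i < n" "c i \<noteq> 0" using less(3) by blast
    have "c k = 0" if "k < n" "k \<noteq> i" for k
      using False i that by (metis linear)
    then have "(\<Sum>k<n. of_int (c k) * a k) = (\<Sum>k\<in>{i}. of_int (c k) * a k)"
      using i by (intro sum.mono_neutral_right) auto
    then have ai: "a i = 0" using less(2) i by simp
    define b where "b = a(i := a (n - 1))"
    have "b k \<in> lspan a n" if "k < n - 1" for k
      using that i by (auto simp: b_def intro!: lspan_base)
    moreover have "a k \<in> lspan b (n - 1)" if k: "k < n" for k
    proof -
      consider "k = i" | "k \<noteq> i" "k < n - 1" | "k \<noteq> i" "k = n - 1" using k by linarith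
      then show ?thesis
      proof cases
        case 1 then show ?thesis by (simp add: ai lspan_zero)
      next
        case 2 then show ?thesis using lspan_base[of k "n - 1" b] by (simp add: b_def)
      next
        case 3 then show ?thesis using lspan_base[of i "n - 1" b] i by (simp add: b_def)
      qed
    qed
    ultimately show ?thesis by blast
  qed
qed

text \<open>Over the integers a dual system exists in general only up to a common nonzero factor, so
  \<open>c\<close> picks up a new factor at each step of the induction.\<close>

lemma lindep_dual:
  assumes "lindep a n"
  shows "\<exists>(f :: nat \<Rightarrow> int poly \<Rightarrow> int) c. c \<noteq> 0 \<and> (\<forall>j<n. \<forall>x y. f j (x + y) = f j x + f j y) \<and>
           (\<forall>i<n. \<forall>j<n. f j (a i) = (if i = j then c else 0))"
  using assms
proof (induction n)
  case 0
  show ?case by (intro exI[of _ "\<lambda>_ _. 0"] exI[of _ 1]) simp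
next
  case (Suc n)
  have "lindep a n" unfolding lindep_def
  proof (intro allI impI)
    fix c :: "nat \<Rightarrow> int" and i
    assume c: "(\<Sum>i<n. of_int (c i) * a i) = 0" and "i < n"
    have "(\<Sum>i<Suc n. of_int ((c(n := 0)) i) * a i) = 0" using c by simp
    then show "c i = 0" using lindepD[OF Suc.prems, of "c(n := 0)" i] \<open>i < n\<close> by simp
  qed
  then obtain f c where c: "c \<noteq> 0" and f: "\<And>j x y. j < n \<Longrightarrow> f j (x + y) = f j x + f j y"
    and fa: "\<And>i j. i < n \<Longrightarrow> j < n \<Longrightarrow> f j (a i) = (if i = j then c else (0 :: int))"
    using Suc.IH by blast
  \<comment> \<open>\<open>e\<close> is additive, kills \<open>a i\<close> for \<open>i < n\<close>
    and, by independence, does not kill \<open>a n\<close>. A coefficient of \<open>e x\<close> that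
    is nonzero at \<open>a n\<close> gives the new functional and corrects the old ones.\<close>
  define e where "e x = of_int c * x - (\<Sum>j<n. of_int (f j x) * a j)" for x
  have e_add: "e (x + y) = e x + e y" for x y
    by (simp add: e_def f algebra_simps sum.distrib)
  have e_base: "e (a i) = 0" if "i < n" for i
  proof -
    have "(\<Sum>j<n. of_int (f j (a i)) * a j) = (\<Sum>j<n. if j = i then of_int c * a i else 0)"
      using that by (intro sum.cong) (auto simp: fa)
    then show ?thesis using that by (simp add: e_def)
  qed
  have "e (a n) \<noteq> 0"
  proof
    assume "e (a n) = 0"
    then have "(\<Sum>j<Suc n. of_int (if j = n then c else - f j (a n)) * a j) = 0"
      by (simp add: e_def sum_negf)
    then show False
      using lindepD[OF Suc.prems, of "\<lambda>j. if j = n then c else - f j (a n)" n] c by simp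
  qed
  then obtain k where k: "Polynomial.coeff (e (a n)) k \<noteq> 0"
    by (auto simp: poly_eq_iff)
  define d where "d = Polynomial.coeff (e (a n)) k"
  define g where "g j x = (if j = n then c * Polynomial.coeff (e x) k
      else d * f j x - f j (a n) * Polynomial.coeff (e x) k)" for j x
  have "c * d \<noteq> 0" using c k by (simp add: d_def)
  moreover have "g j (x + y) = g j x + g j y" if "j < Suc n" for j x y
    using that by (auto simp: g_def e_add f algebra_simps)
  moreover have "g j (a i) = (if i = j then c * d else 0)" if "i < Suc n" "j < Suc n" for i j
    using that by (cases "i = n"; cases "j = n") (auto simp: g_def e_base fa d_def)
  ultimately show ?case by (intro exI[of _ g] exI[of _ "c * d"]) blast
qed

lemma additive_lin_comb:
  fixes n :: nat
  assumes f: "\<And>x y. f (x + y) = f x + (f y :: int)"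
  shows "f (\<Sum>i<n. of_int (c i) * (a i :: int poly)) = (\<Sum>i<n. c i * f (a i))"
proof -
  have zero: "f 0 = 0" using f[of 0 0] by simp
  have neg: "f (- x) = - f x" for x using f[of x "- x"] zero by simp
  have nat: "f (of_nat k * x) = int k * f x" for k x
    by (induction k) (simp_all add: zero f algebra_simps)
  have int: "f (of_int k * x) = k * f x" for k x
  proof (cases k rule: int_cases2)
    case (nonneg m) then show ?thesis using nat[of m x] by simp
  next
    case (nonpos m) then show ?thesis using nat[of m x] neg[of "of_nat m * x"] by simp
  qed
  show ?thesis by (induction n) (simp_all add: zero f int)
qed

text \<open>Comparing widths in the directions dual to the \<open>a i\<close> bounds the column sums of the integer
  matrix expressing \<open>b\<close> through \<open>a\<close> by 1, while its rows are nonzero.\<close>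

lemma signed_permutation_of_divisibility:
  assumes indep: "lindep a m" and "e \<noteq> 0" and "m > 0"
  obtains N :: nat where "\<And>b v. (\<And>i. i < m \<Longrightarrow> b i \<in> lspan a m) \<Longrightarrow>
      (\<Prod>i<m. 1 - mon (b i)) ^ N * v = (\<Prod>i<m. 1 - mon (a i)) ^ N * e \<Longrightarrow>
      \<exists>p. bij_betw p {..<m} {..<m} \<and> (\<forall>i<m. b i = a (p i) \<or> b i = - a (p i))"
proof -
  obtain f and d :: int where d: "d \<noteq> 0"
    and f: "\<And>j x y. j < m \<Longrightarrow> f j (x + y) = f j x + (f j y :: int)"
    and fa: "\<And>i j. i < m \<Longrightarrow> j < m \<Longrightarrow> f j (a i) = (if i = j then d else 0)"
    using lindep_dual[OF indep] by blast
  \<comment> \<open>\<open>N\<close> depends only on \<open>a\<close> and \<open>e\<close>, exceeds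
    the width of \<open>e\<close> in every dual direction and is positive.\<close>
  define N where "N = Suc (\<Sum>j<m. nat (width (f j) e))"
  have N: "width (f j) e < int N" if "j < m" for j
  proof -
    have "nat (width (f j) e) \<le> (\<Sum>j<m. nat (width (f j) e))"
      using that by (intro member_le_sum) auto
    then show ?thesis unfolding N_def by linarith
  qed
  show ?thesis
  proof (rule that[of N])
    fix b v
    assume span: "\<And>i. i < m \<Longrightarrow> b i \<in> lspan a m"
      and eq: "(\<Prod>i<m. 1 - mon (b i)) ^ N * v = (\<Prod>i<m. 1 - mon (a i)) ^ N * e"
    have "\<forall>i\<in>{..<m}. \<exists>c :: nat \<Rightarrow> int. b i = (\<Sum>j<m. of_int (c j) * a j)"
      using span by (auto simp: lspan_def)
    then obtain C :: "nat \<Rightarrow> nat \<Rightarrow> int"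
      where "\<forall>i\<in>{..<m}. b i = (\<Sum>j<m. of_int (C i j) * a j)"
      by (rule bchoice[THEN exE])
    then have C: "\<And>i. i < m \<Longrightarrow> b i = (\<Sum>j<m. of_int (C i j) * a j)" by auto
    have nz_a: "(\<Prod>i<m. 1 - mon (a i)) \<noteq> 0"
      using lindep_nonzero[OF indep] by (auto simp: one_minus_mon_eq_0_iff simp del: right_minus_eq)
    then have "(\<Prod>i<m. 1 - mon (b i)) ^ N * v \<noteq> 0"
      unfolding eq using \<open>e \<noteq> 0\<close> by simp
    then have "(\<Prod>i<m. 1 - mon (b i)) \<noteq> 0" and "v \<noteq> 0" by (auto simp: N_def)
    then have nz_b: "b i \<noteq> 0" if "i < m" for i
      using that by (metis finite_lessThan lessThan_iff one_minus_mon_eq_0_iff prod_zero)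
    \<comment> \<open>Widths in direction \<open>f j\<close> give
      \<open>N * |d| * S + width v = N * |d| + width e\<close> for the column sum \<open>S\<close>.
      As \<open>width e < N \<le> N * |d|\<close> and \<open>width v \<ge> 0\<close>, this forces
      \<open>S < 2\<close>.\<close>
    have col: "(\<Sum>i<m. \<bar>C i j\<bar>) < 2" if j: "j < m" for j
    proof -
      have fb: "f j (b i) = C i j * d" if "i < m" for i
      proof -
        have "f j (b i) = (\<Sum>k<m. C i k * f j (a k))"
          unfolding C[OF that] by (rule additive_lin_comb) (rule f[OF j])
        also have "\<dots> = (\<Sum>k<m. if k = j then C i j * d else 0)"
          by (intro sum.cong) (auto simp: fa j)
        finally show ?thesis using j by simp
      qed
      have w: "width (f j) ((\<Prod>i<m. 1 - mon (x i)) ^ N * z)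
          = int N * (\<Sum>i<m. \<bar>f j (x i)\<bar>) + width (f j) z"
        if "\<And>i. i < m \<Longrightarrow> x i \<noteq> 0" "z \<noteq> 0" for x z
      proof -
        have nz: "1 - mon (x i) \<noteq> 0" if "i < m" for i
          using \<open>\<And>i. i < m \<Longrightarrow> x i \<noteq> 0\<close> that by (simp add: one_minus_mon_eq_0_iff del: right_minus_eq)
        then have "(\<Prod>i<m. 1 - mon (x i)) \<noteq> 0" by (subst prod_zero_iff) auto
        moreover have "width (f j) (\<Prod>i<m. 1 - mon (x i)) = (\<Sum>i<m. width (f j) (1 - mon (x i)))"
          using nz f[OF j] by (intro width_prod) auto
        moreover have "\<dots> = (\<Sum>i<m. \<bar>f j (x i)\<bar>)"
          using that(1) f[OF j] by (intro sum.cong refl width_one_minus_mon) auto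
        ultimately show ?thesis
          using \<open>z \<noteq> 0\<close> by (simp add: width_mult f j width_power del: right_minus_eq)
      qed
      have "int N * (\<Sum>i<m. \<bar>C i j * d\<bar>) + width (f j) v
          = int N * (\<Sum>i<m. \<bar>f j (a i)\<bar>) + width (f j) e"
        using w[of b v] w[of a e] eq nz_b \<open>v \<noteq> 0\<close> \<open>e \<noteq> 0\<close> lindep_nonzero[OF indep] by (simp add: fb)
      moreover have "(\<Sum>i<m. \<bar>f j (a i)\<bar>) = (\<Sum>i<m. if i = j then \<bar>d\<bar> else 0)"
        using j by (intro sum.cong) (auto simp: fa)
      moreover have "(\<Sum>i<m. if i = j then \<bar>d\<bar> else 0) = \<bar>d\<bar>" using j by simp
      moreover have "(\<Sum>i<m. \<bar>C i j * d\<bar>) = (\<Sum>i<m. \<bar>C i j\<bar>) * \<bar>d\<bar>"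
        by (simp add: abs_mult sum_distrib_right)
      ultimately have "int N * ((\<Sum>i<m. \<bar>C i j\<bar>) * \<bar>d\<bar>) + width (f j) v = int N * \<bar>d\<bar> + width (f j) e"
        by metis
      moreover have "0 \<le> width (f j) v" using \<open>v \<noteq> 0\<close> by (rule width_nonneg)
      ultimately have "int N * ((\<Sum>i<m. \<bar>C i j\<bar>) * \<bar>d\<bar>) < int N * \<bar>d\<bar> + int N"
        using N[OF j] by linarith
      also have "\<dots> \<le> int N * \<bar>d\<bar> + int N * \<bar>d\<bar>"
      proof -
        have "1 \<le> \<bar>d\<bar>" using d by linarith
        then show ?thesis using mult_left_mono[of 1 "\<bar>d\<bar>" "int N"] by (simp add: mult.commute)
      qed
      finally have "int N * \<bar>d\<bar> * (\<Sum>i<m. \<bar>C i j\<bar>) < int N * \<bar>d\<bar> * 2"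
        by (simp add: algebra_simps)
      moreover have "0 < int N * \<bar>d\<bar>" using d unfolding N_def by (intro mult_pos_pos) linarith+
      ultimately show ?thesis by (simp only: mult_less_cancel_left_pos)
    qed
    have "\<exists>j<m. C i j \<noteq> 0" if "i < m" for i
    proof (rule ccontr)
      assume "\<not> (\<exists>j<m. C i j \<noteq> 0)"
      then have "b i = 0" unfolding C[OF that] by (intro sum.neutral) auto
      then show False using nz_b that by blast
    qed
    then obtain p where p: "\<And>i. i < m \<Longrightarrow> p i < m \<and> C i (p i) \<noteq> 0" by metis
    \<comment> \<open>A column of integers with absolute sum below 2 has at most one nonzero entry.
      Hence \<open>p\<close> is injective, and so bijective on the finite index set.\<close>
    have unique: "i = i'" if "i < m" "i' < m" "j < m" "C i j \<noteq> 0" "C i' j \<noteq> 0" for i i' j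
    proof (rule ccontr)
      assume "i \<noteq> i'"
      then have "\<bar>C i j\<bar> + \<bar>C i' j\<bar> = (\<Sum>k\<in>{i, i'}. \<bar>C k j\<bar>)" by simp
      also have "\<dots> \<le> (\<Sum>k<m. \<bar>C k j\<bar>)" using that by (intro sum_mono2) auto
      finally show False using col[OF that(3)] that(4,5) by linarith
    qed
    have "inj_on p {..<m}" using p unique by (metis inj_onI lessThan_iff)
    moreover have "p ` {..<m} \<subseteq> {..<m}" using p by auto
    ultimately have surj: "p ` {..<m} = {..<m}" using endo_inj_surj by blast
    have "b i = a (p i) \<or> b i = - a (p i)" if i: "i < m" for i
    proof -
      \<comment> \<open>By surjectivity of \<open>p\<close>, column \<open>j\<close> is already
        occupied by another row \<open>i'\<close>.\<close>
      have z: "C i j = 0" if "j < m" "j \<noteq> p i" for j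
      proof -
        have "j \<in> p ` {..<m}" unfolding surj using that by simp
        then obtain i' where "i' < m" "j = p i'" by auto
        then show ?thesis using unique[of i i' j] p i that by blast
      qed
      have "b i = (\<Sum>j\<in>{p i}. of_int (C i j) * a j)"
        unfolding C[OF i] using p[OF i] z by (intro sum.mono_neutral_right) auto
      moreover have "\<bar>C i (p i)\<bar> \<le> (\<Sum>k<m. \<bar>C k (p i)\<bar>)"
        using i by (intro member_le_sum) auto
      then have "C i (p i) = 1 \<or> C i (p i) = -1"
        using col[of "p i"] p[OF i] by linarith
      ultimately show ?thesis by auto
    qed
    then show "\<exists>p. bij_betw p {..<m} {..<m} \<and> (\<forall>i<m. b i = a (p i) \<or> b i = - a (p i))"
      using surj \<open>inj_on p {..<m}\<close> by (auto simp: bij_betw_def)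
  qed
qed

text \<open>Extending \<open>p\<close> by the identity gives a permutation \<open>q\<close> of the
  naturals moving finitely many points, hence of finite order.\<close>

lemma bij_betw_funpow_id:
  assumes "bij_betw p {..<m} {..<m :: nat}"
  obtains n where "\<And>i. i < m \<Longrightarrow> (p ^^ n) i = i" "n > 0"
proof -
  define q where "q i = (if i < m then p i else i)" for i
  have qp: "q i = p i" if "i < m" for i using that by (simp add: q_def)
  have q: "q permutes {..<m}"
    using assms bij_betw_cong[of "{..<m}" q p "{..<m}"] by (intro bij_imp_permutes) (auto simp: q_def)
  then have "permutation q" using permutation_permutes by blast
  then obtain n where n: "(q ^^ n) = id" "n > 0" using permutation_is_nilpotent by blast
  have "(p ^^ k) i = (q ^^ k) i \<and> (q ^^ k) i < m" if "i < m" for k i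
  proof (induction k)
    case (Suc k)
    have "q ((q ^^ k) i) < m" using permutes_in_image[OF q, of "(q ^^ k) i"] Suc by simp
    moreover have "q ((q ^^ k) i) = p ((q ^^ k) i)" using qp Suc by blast
    ultimately show ?case using Suc by simp
  qed (use that in simp)
  then show ?thesis using n that[of n] by simp
qed

section \<open>Crossed homomorphisms on a group\<close>

text \<open>Crossed homomorphisms, with \<open>x\<close> acting as multiplication by
  \<open>mon (ab x)\<close>. They are taken relative to \<open>K\<close> because the difference of
  Fox derivatives under an endomorphism is controlled only on \<open>H\<close>.\<close>

definition (in group) cocycle :: "('a \<Rightarrow> int poly) \<Rightarrow> 'a set \<Rightarrow> ('a \<Rightarrow> laurent) \<Rightarrow> bool" where
  "cocycle ab K d \<longleftrightarrow> (\<forall>x\<in>K. \<forall>y\<in>K. d (x \<otimes> y) = d x + mon (ab x) * d y)"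

definition (in group) additive :: "('a \<Rightarrow> int poly) \<Rightarrow> bool" where
  "additive f \<longleftrightarrow> (\<forall>x\<in>carrier G. \<forall>y\<in>carrier G. f (x \<otimes> y) = f x + f y)"

context group
begin

lemma additive_mult: "additive f \<Longrightarrow> x \<in> carrier G \<Longrightarrow> y \<in> carrier G \<Longrightarrow> f (x \<otimes> y) = f x + f y"
  by (simp add: additive_def)

lemma additive_one: "additive f \<Longrightarrow> f \<one> = 0"
  using additive_mult[of f \<one> \<one>] by simp

lemma additive_inv:
  assumes "additive f" "x \<in> carrier G"
  shows "f (inv x) = - f x"
  using additive_mult[of f x "inv x"] additive_one[OF assms(1)] assms
  by (simp add: eq_neg_iff_add_eq_0 add.commute)

lemma additive_derived:
  assumes "additive f" "K \<subseteq> carrier G" "x \<in> derived G K"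
  shows "f x = 0"
proof -
  have "x \<in> generate G (derived_set G K)" using assms(3) by (simp add: derived_def)
  then have "x \<in> carrier G \<and> f x = 0"
  proof (induction rule: generate.induct)
    case (incl h)
    then show ?case using assms(2) additive_mult[OF assms(1)] additive_inv[OF assms(1)]
      by (auto simp: subset_iff)
  next
    case (inv h)
    then show ?case using assms(2) additive_mult[OF assms(1)] additive_inv[OF assms(1)]
      by (auto simp: subset_iff)
  next
    case (eng h1 h2)
    then show ?case using additive_mult[OF assms(1)] by auto
  qed (simp add: additive_one assms(1))
  then show ?thesis ..
qed

lemma additive_generate:
  assumes "S \<subseteq> carrier G" "x \<in> generate G S" "additive f"
    and base: "\<And>s. s \<in> S \<Longrightarrow> f s \<in> lspan a n"
  shows "f x \<in> lspan a n"
proof -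
  have "x \<in> carrier G \<and> f x \<in> lspan a n"
    using assms(2)
  proof (induction rule: generate.induct)
    case one show ?case by (simp add: additive_one assms(3) lspan_zero)
  next
    case (incl h) then show ?case using base assms(1) by auto
  next
    case (inv h)
    then have "h \<in> carrier G" using assms(1) by auto
    then show ?case using inv base by (simp add: additive_inv[OF assms(3)] lspan_uminus)
  next
    case (eng h1 h2)
    then show ?case by (simp add: additive_mult[OF assms(3)] lspan_add)
  qed
  then show ?thesis ..
qed

text \<open>The element is the product of the powers of \<open>h i\<close> with exponents
  \<open>c i\<close>. One \<open>g\<close> serves all additive \<open>f\<close> at once, so
  \<open>ab\<close> and its composite with an endomorphism can be evaluated on the same
  element.\<close>

lemma generate_lin_comb:
  fixes c :: "nat \<Rightarrow> int"
  assumes "h ` {..<n} \<subseteq> carrier G"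
  shows "\<exists>g\<in>generate G (h ` {..<n}). \<forall>f. additive f \<longrightarrow> f g = (\<Sum>i<n. of_int (c i) * f (h i))"
proof -
  let ?S = "generate G (h ` {..<n})"
  have sg: "subgroup ?S G" using assms by (rule generate_is_subgroup)
  have carr: "x \<in> carrier G" if "x \<in> ?S" for x
    using subgroup.subset[OF sg] that by blast
  have pow: "\<exists>y\<in>?S. \<forall>f. additive f \<longrightarrow> f y = of_int k * f x" if x: "x \<in> ?S" for x k
  proof -
    have nat: "\<exists>y\<in>?S. \<forall>f. additive f \<longrightarrow> f y = of_nat m * f x" for m
    proof (induction m)
      case 0
      show ?case by (intro bexI[of _ \<one>]) (auto simp: additive_one generate.one)
    next
      case (Suc m)
      then obtain y where y: "y \<in> ?S" "\<And>f. additive f \<Longrightarrow> f y = of_nat m * f x" by auto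
      then show ?case using x carr
        by (intro bexI[of _ "y \<otimes> x"]) (auto simp: additive_mult algebra_simps generate.eng)
    qed
    show ?thesis
    proof (cases k rule: int_cases2)
      case (nonneg m)
      then show ?thesis using nat[of m] by simp
    next
      case (nonpos m)
      obtain y where y: "y \<in> ?S" "\<And>f. additive f \<Longrightarrow> f y = of_nat m * f x"
        using nat[of m] by auto
      then show ?thesis using nonpos carr subgroup.m_inv_closed[OF sg]
        by (intro bexI[of _ "inv y"]) (auto simp: additive_inv)
    qed
  qed
  have "\<exists>g\<in>?S. \<forall>f. additive f \<longrightarrow> f g = (\<Sum>i<k. of_int (c i) * f (h i))" if "k \<le> n" for k
    using that
  proof (induction k)
    case 0
    show ?case by (intro bexI[of _ \<one>]) (auto simp: additive_one generate.one)
  next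
    case (Suc k)
    then obtain g where g: "g \<in> ?S" "\<And>f. additive f \<Longrightarrow> f g = (\<Sum>i<k. of_int (c i) * f (h i))"
      by auto
    have "h k \<in> ?S" using Suc.prems by (auto intro: generate.incl)
    then obtain y where y: "y \<in> ?S" "\<And>f. additive f \<Longrightarrow> f y = of_int (c k) * f (h k)"
      using pow by blast
    show ?case using g y carr
      by (intro bexI[of _ "g \<otimes> y"]) (auto simp: additive_mult generate.eng)
  qed
  then show ?thesis by blast
qed

context
  fixes ab K d
  assumes ab: "additive ab" and K: "subgroup K G" and d: "cocycle ab K d"
begin

lemma cocycle_mult: "x \<in> K \<Longrightarrow> y \<in> K \<Longrightarrow> d (x \<otimes> y) = d x + mon (ab x) * d y"
  using d by (simp add: cocycle_def)

lemma cocycle_one: "d \<one> = 0"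
  using cocycle_mult[of \<one> \<one>] subgroup.one_closed[OF K] by (simp add: additive_one ab)

lemma cocycle_inv:
  assumes "x \<in> K"
  shows "d (inv x) = - (mon (- ab x) * d x)"
proof -
  have x: "x \<in> carrier G" "inv x \<in> K"
    using assms subgroup.mem_carrier[OF K] subgroup.m_inv_closed[OF K] by auto
  have "0 = d (inv x) + mon (- ab x) * d x"
    using cocycle_mult[of "inv x" x] assms x by (simp add: cocycle_one additive_inv ab)
  then show ?thesis by (simp add: eq_neg_iff_add_eq_0)
qed

text \<open>The terms from \<open>x\<close> and \<open>inv x\<close> combine because exponents
  commute. Each summand gains a factor \<open>1 - mon _\<close>, which pushes values on commutators
  deeper into the augmentation filtration.\<close>

lemma cocycle_commutator:
  assumes "x \<in> K" "y \<in> K"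
  shows "d (x \<otimes> y \<otimes> inv x \<otimes> inv y) = (1 - mon (ab y)) * d x - (1 - mon (ab x)) * d y"
proof -
  have c: "x \<in> carrier G" "y \<in> carrier G" using assms subgroup.mem_carrier[OF K] by auto
  have i: "inv x \<in> K" "inv y \<in> K" "x \<otimes> y \<in> K" "x \<otimes> y \<otimes> inv x \<in> K"
    using assms subgroup.m_inv_closed[OF K] subgroup.m_closed[OF K] by auto
  have "d (x \<otimes> y \<otimes> inv x \<otimes> inv y)
     = d x + mon (ab x) * d y - mon (ab x + ab y) * mon (- ab x) * d x - mon (ab y) * mon (- ab y) * d y"
    using assms c i by (simp add: cocycle_mult cocycle_inv additive_mult[OF ab] additive_inv[OF ab] algebra_simps)
  then show ?thesis by (simp add: mon_mult algebra_simps)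
qed

text \<open>On the kernel of \<open>ab\<close>, commutation with \<open>x\<close> realises
  multiplication by \<open>1 - mon (ab x)\<close>, so module multiples can be written as group
  words.\<close>

lemma cocycle_twist:
  assumes "x \<in> K" "c \<in> K" "ab c = 0"
  shows "d (c \<otimes> (x \<otimes> inv c \<otimes> inv x)) = (1 - mon (ab x)) * d c"
proof -
  have "c \<otimes> (x \<otimes> inv c \<otimes> inv x) = c \<otimes> x \<otimes> inv c \<otimes> inv x"
    using assms subgroup.mem_carrier[OF K] by (simp add: m_assoc)
  then show ?thesis using cocycle_commutator[of c x] assms by simp
qed

end

text \<open>Induction on \<open>k\<close> gives \<open>vanishes k (d g)\<close> on all of
  \<open>K\<close>. On the derived subgroup the commutator formula gains one level per step; modulo
  it, \<open>K\<close> is generated by the \<open>h i\<close>, where \<open>d\<close> is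
  zero.\<close>

lemma cocycle_eq_zero:
  assumes ab: "additive ab" and K: "subgroup K G" and d: "cocycle ab K d"
    and h: "\<And>i. i < n \<Longrightarrow> h i \<in> K" "\<And>i. i < n \<Longrightarrow> d (h i) = 0"
    and span: "\<And>g. g \<in> K \<Longrightarrow> ab g \<in> lspan (\<lambda>i. ab (h i)) n"
    and ker: "\<And>g. g \<in> K \<Longrightarrow> ab g = 0 \<Longrightarrow> g \<in> derived G K"
    and "g \<in> K"
  shows "d g = 0"
proof -
  note mult = cocycle_mult[OF ab K d] and d_one = cocycle_one[OF ab K d]
    and cinv = cocycle_inv[OF ab K d] and comm = cocycle_commutator[OF ab K d]
  have Kc: "K \<subseteq> carrier G" by (rule subgroup.subset[OF K])
  have gK: "generate G (h ` {..<n}) \<subseteq> K"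
    using h by (intro generate_subgroup_incl[OF _ K]) auto
  have gen0: "d w = 0" if "w \<in> generate G (h ` {..<n})" for w
    using that
  proof (induction rule: generate.induct)
    case (eng h1 h2)
    then show ?case using gK by (subst mult) auto
  qed (use h d_one cinv in auto)
  have "\<forall>g\<in>K. vanishes k (d g)" for k
  proof (induction k)
    case (Suc k)
    have der: "vanishes (Suc k) (d c)" if "c \<in> derived G K" for c
    proof -
      have "c \<in> generate G (derived_set G K)" using that by (simp add: derived_def)
      then have "c \<in> K \<and> ab c = 0 \<and> vanishes (Suc k) (d c)"
      proof (induction rule: generate.induct)
        case one
        show ?case using d_one by (auto simp: additive_one[OF ab] subgroup.one_closed[OF K])
      next
        case (incl c)
        then obtain x y where xy: "x \<in> K" "y \<in> K" "c = x \<otimes> y \<otimes> inv x \<otimes> inv y" by auto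
        then have "c \<in> K" using subgroup.m_inv_closed[OF K] subgroup.m_closed[OF K] by auto
        moreover have "ab c = 0" using xy Kc
          by (auto simp: additive_mult[OF ab] additive_inv[OF ab] subset_iff)
        moreover have "vanishes (Suc k) (d c)" unfolding xy(3) comm[OF xy(1,2)]
          using Suc.IH xy by (intro vanishes_diff vanishes_Suc_one_minus_mon) auto
        ultimately show ?case by simp
      next
        case (inv c)
        then obtain x y where xy: "x \<in> K" "y \<in> K" "c = x \<otimes> y \<otimes> inv x \<otimes> inv y" by auto
        then have c: "c \<in> K" using subgroup.m_inv_closed[OF K] subgroup.m_closed[OF K] by auto
        moreover have "ab c = 0" using xy Kc
          by (auto simp: additive_mult[OF ab] additive_inv[OF ab] subset_iff)
        moreover have "vanishes (Suc k) (d c)" unfolding xy(3) comm[OF xy(1,2)]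
          using Suc.IH xy by (intro vanishes_diff vanishes_Suc_one_minus_mon) auto
        ultimately show ?case using Kc subgroup.m_inv_closed[OF K]
          by (auto simp: additive_inv[OF ab] cinv vanishes_uminus subset_iff)
      next
        case (eng c c')
        then show ?case using Kc subgroup.m_closed[OF K]
          by (auto simp: additive_mult[OF ab] mult vanishes_add subset_iff)
      qed
      then show ?thesis by blast
    qed
    show ?case
    proof
      fix g assume g: "g \<in> K"
      obtain c :: "nat \<Rightarrow> int" where c: "ab g = (\<Sum>i<n. of_int (c i) * ab (h i))"
        using span[OF g] by (auto simp: lspan_def)
      \<comment> \<open>\<open>w\<close> is a product of powers of the \<open>h i\<close>, so
        \<open>d w = 0\<close>, and \<open>inv w \<otimes> g\<close> lies in the derived
        subgroup.\<close>
      obtain w where w: "w \<in> generate G (h ` {..<n})" "ab w = ab g"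
        using generate_lin_comb[of h n c] h(1) Kc ab c by (auto simp: image_subset_iff)
      have wK: "w \<in> K" using w gK by blast
      have v: "inv w \<otimes> g \<in> K" using wK g subgroup.m_inv_closed[OF K] subgroup.m_closed[OF K] by auto
      have "ab (inv w \<otimes> g) = 0" using wK g w Kc
        by (auto simp: additive_mult[OF ab] additive_inv[OF ab] subset_iff)
      then have "vanishes (Suc k) (d (inv w \<otimes> g))" using ker v der by blast
      moreover have "g = w \<otimes> (inv w \<otimes> g)" using wK g Kc by (auto simp: m_assoc[symmetric] subset_iff)
      then have "d g = mon (ab w) * d (inv w \<otimes> g)"
        using mult[OF wK v] gen0[OF w(1)] by simp
      ultimately show "vanishes (Suc k) (d g)" by (simp add: vanishes_mon_mult)
    qed
  qed simp
  then show ?thesis using \<open>g \<in> K\<close> vanishes_all_imp_zero by blast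
qed

text \<open>Being a group word, it is carried along by endomorphisms. Folded over a list
  \<open>xs\<close> it applies the product of the factors \<open>1 - mon (ab x)\<close> to an
  element of the kernel of \<open>ab\<close>.\<close>

definition twist :: "'a \<Rightarrow> 'a \<Rightarrow> 'a" where
  "twist x c = c \<otimes> (x \<otimes> inv c \<otimes> inv x)"

lemma cocycle_foldr_twist:
  assumes "additive ab" "cocycle ab (carrier G) d" "set xs \<subseteq> carrier G" "c \<in> carrier G" "ab c = 0"
  shows "foldr twist xs c \<in> carrier G \<and> ab (foldr twist xs c) = 0 \<and>
         d (foldr twist xs c) = (\<Prod>x\<leftarrow>xs. 1 - mon (ab x)) * d c"
  using assms(3)
proof (induction xs)
  case Nil
  then show ?case using assms by simp
next
  case (Cons x xs)
  then show ?case
    using cocycle_twist[OF assms(1) subgroup_self assms(2), of x "foldr twist xs c"]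
    by (auto simp: twist_def[of x "foldr twist xs c"] additive_mult[OF assms(1)] additive_inv[OF assms(1)] mult_ac)
qed

lemma foldr_twist_closed:
  assumes "subgroup K G" "set xs \<subseteq> K" "c \<in> K"
  shows "foldr twist xs c \<in> K"
  using assms(2)
  by (induction xs) (auto simp: twist_def assms subgroup.m_closed[OF assms(1)] subgroup.m_inv_closed[OF assms(1)])

lemma hom_foldr_twist:
  assumes "f \<in> hom G G" "set xs \<subseteq> carrier G" "c \<in> carrier G"
  shows "f (foldr twist xs c) = foldr twist (map f xs) (f c)"
proof -
  interpret f: group_hom G G f using assms(1) by unfold_locales
  have twist: "f (twist x y) = twist (f x) (f y)" if "x \<in> carrier G" "y \<in> carrier G" for x y
    using that by (simp add: twist_def)
  show ?thesis
    using assms(2)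
  proof (induction xs)
    case (Cons x xs)
    then have "foldr twist xs c \<in> carrier G"
      using foldr_twist_closed[OF subgroup_self] assms(3) by auto
    then show ?case using Cons by (auto simp: twist)
  qed simp
qed

end

section \<open>Groups with faithful Fox derivatives\<close>

text \<open>What the argument uses of the Magnus embedding: \<open>D x j\<close> is the
  \<open>j\<close>-th Fox derivative, \<open>fox_faithful\<close> is injectivity, and
  \<open>moment_0_D\<close> says that the augmentation of a derivative is an exponent sum.\<close>

locale fox_group = group +
  fixes ab :: "'a \<Rightarrow> int poly" and D :: "'a \<Rightarrow> nat \<Rightarrow> laurent"
  assumes ab: "additive ab"
    and D: "cocycle ab (carrier G) (\<lambda>x. D x j)"
    and fox_faithful: "x \<in> carrier G \<Longrightarrow> ab x = 0 \<Longrightarrow> (\<And>j. D x j = 0) \<Longrightarrow> x = \<one>"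
    and moment_0_D: "x \<in> carrier G \<Longrightarrow> moment 0 (D x j) = of_int (Polynomial.coeff (ab x) j)"
    and ab_kernel: "x \<in> carrier G \<Longrightarrow> ab x = 0 \<Longrightarrow> x \<in> derived G (carrier G)"
begin

lemmas ab_mult = additive_mult[OF ab]
  and ab_one = additive_one[OF ab]
  and ab_inv = additive_inv[OF ab]
  and D_mult = cocycle_mult[OF ab subgroup_self D]
  and D_inv = cocycle_inv[OF ab subgroup_self D]
  and D_commutator = cocycle_commutator[OF ab subgroup_self D]

lemma fox_eqI:
  assumes "x \<in> carrier G" "y \<in> carrier G" "ab x = ab y" "\<And>j. D x j = D y j"
  shows "x = y"
proof -
  have "inv x \<otimes> y = \<one>"
    using assms by (intro fox_faithful) (auto simp: ab_mult ab_inv D_mult D_inv)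
  then show ?thesis using assms inv_equality[of "inv x" y] by (metis inv_closed inv_inv)
qed

text \<open>The kernel of \<open>ab\<close> is the derived subgroup, which is also killed by the
  additive map \<open>ab\<close> after \<open>f\<close>. Thus \<open>f\<close> acts on the image of
  \<open>ab\<close>.\<close>

lemma hom_ab_cong:
  assumes f: "f \<in> hom G G" and "x \<in> carrier G" "y \<in> carrier G" "ab x = ab y"
  shows "ab (f x) = ab (f y)"
proof -
  interpret f: group_hom G G f using f by unfold_locales
  have add: "additive (\<lambda>x. ab (f x))" by (simp add: additive_def ab_mult)
  have "inv y \<otimes> x \<in> derived G (carrier G)"
    using assms by (intro ab_kernel) (auto simp: ab_mult ab_inv)
  then have "ab (f (inv y \<otimes> x)) = 0"
    using additive_derived[OF add subset_refl] by simp
  then show ?thesis using assms by (simp add: ab_mult ab_inv)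
qed

lemma hom_ab_eq_on:
  assumes f: "f \<in> hom G G" and h: "\<And>i. i < n \<Longrightarrow> h i \<in> carrier G" "\<And>i. i < n \<Longrightarrow> ab (f (h i)) = ab (h i)"
    and "g \<in> carrier G" "ab g \<in> lspan (\<lambda>i. ab (h i)) n"
  shows "ab (f g) = ab g"
proof -
  interpret f: group_hom G G f using f by unfold_locales
  have add: "additive (\<lambda>x. ab (f x))" by (simp add: additive_def ab_mult)
  obtain c :: "nat \<Rightarrow> int" where c: "ab g = (\<Sum>i<n. of_int (c i) * ab (h i))"
    using assms(5) by (auto simp: lspan_def)
  have hc: "h ` {..<n} \<subseteq> carrier G" using h by auto
  obtain w where w: "w \<in> generate G (h ` {..<n})"
    "\<And>f. additive f \<Longrightarrow> f w = (\<Sum>i<n. of_int (c i) * f (h i))"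
    using generate_lin_comb[OF hc, of c] by auto
  have wc: "w \<in> carrier G" using w(1) generate_in_carrier[OF hc] by blast
  have "ab w = ab g" using w(2)[OF ab] c by simp
  moreover have "ab (f w) = (\<Sum>i<n. of_int (c i) * ab (f (h i)))" using w(2)[OF add] .
  then have "ab (f w) = ab g" unfolding c using h by simp
  ultimately show ?thesis using hom_ab_cong[OF f assms(4) wc] by simp
qed

text \<open>If all Fox derivatives of the commutator vanished, first moments would make every
  \<open>2 \<times> 2\<close> minor of the coefficient matrix of \<open>ab x\<close>, \<open>ab y\<close> vanish.\<close>

lemma commutator_fox_nonzero:
  assumes "lindep a n" "p < n" "q < n" "p \<noteq> q"
    and "x \<in> carrier G" "y \<in> carrier G" "ab x = a p" "ab y = a q"
  shows "\<exists>j. D (x \<otimes> y \<otimes> inv x \<otimes> inv y) j \<noteq> 0"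
proof (rule ccontr)
  assume neg: "\<not> (\<exists>j. D (x \<otimes> y \<otimes> inv x \<otimes> inv y) j \<noteq> 0)"
  have moment_1: "moment 1 ((1 - mon b) * u) = - (b * moment 0 u)" for b u
    by (simp add: left_diff_distrib moment_diff moment_mon_mult)
  have eq: "a q * of_int (Polynomial.coeff (a p) j) = a p * of_int (Polynomial.coeff (a q) j)" for j
  proof -
    have "(1 - mon (a q)) * D x j = (1 - mon (a p)) * D y j"
      using neg D_commutator[of x y j] assms by simp
    then have "moment 1 ((1 - mon (a q)) * D x j) = moment 1 ((1 - mon (a p)) * D y j)" by simp
    then show ?thesis using assms by (simp add: moment_1 moment_0_D del: One_nat_def)
  qed
  have "a p \<noteq> 0" using lindep_nonzero assms by blast
  then obtain j where j: "Polynomial.coeff (a p) j \<noteq> 0" by (auto simp: poly_eq_iff)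
  \<comment> \<open>A nonzero coefficient of \<open>a p\<close> turns the \<open>j\<close>-th
    equation into a nontrivial integral relation between \<open>a p\<close> and
    \<open>a q\<close>.\<close>
  define c where "c i = (if i = p then - Polynomial.coeff (a q) j else
    if i = q then Polynomial.coeff (a p) j else 0)" for i
  have "(\<Sum>i<n. of_int (c i) * a i) = (\<Sum>i\<in>{p, q}. of_int (c i) * a i)"
    using assms by (intro sum.mono_neutral_right) (auto simp: c_def)
  also have "\<dots> = 0" using \<open>p \<noteq> q\<close> eq[of j] by (simp add: c_def algebra_simps)
  finally have "c q = 0" using lindepD assms(1,3) by blast
  then show False using j \<open>p \<noteq> q\<close> by (simp add: c_def)
qed

section \<open>Powers of endomorphisms and criteria for a retract\<close>

lemma hom_funpow:
  assumes "f \<in> hom G G"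
  shows "(f ^^ n) \<in> hom G G"
proof (induction n)
  case 0 then show ?case by (simp add: hom_def)
next
  case (Suc n) then show ?case using assms by (auto simp: hom_def Pi_iff)
qed

text \<open>If \<open>p ^^ n\<close> fixes all indices, \<open>f ^^ n\<close> sends each
  \<open>ab (h i)\<close> to plus or minus itself; doubling the exponent removes the signs.\<close>

lemma hom_power_ab_id:
  fixes m :: nat
  assumes f: "f \<in> hom G G" and h: "\<And>i. i < m \<Longrightarrow> h i \<in> carrier G"
    and p: "bij_betw p {..<m} {..<m}"
    and perm: "\<And>i. i < m \<Longrightarrow> ab (f (h i)) = ab (h (p i)) \<or> ab (f (h i)) = - ab (h (p i))"
  obtains k where "k > 0" "\<And>i. i < m \<Longrightarrow> ab ((f ^^ k) (h i)) = ab (h i)"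
proof -
  have neg: "ab (f' x) = - ab (f' y)"
    if "f' \<in> hom G G" "x \<in> carrier G" "y \<in> carrier G" "ab x = - ab y" for f' x y
  proof -
    interpret f': group_hom G G f' using that(1) by unfold_locales
    have "ab (f' x) = ab (f' (inv y))" 
      by (rule hom_ab_cong[OF that(1)]) (use that in \<open>auto simp: ab_inv\<close>)
    then show ?thesis using that by (simp add: ab_inv)
  qed
  obtain n where n: "\<And>i. i < m \<Longrightarrow> (p ^^ n) i = i" "n > 0"
    using bij_betw_funpow_id[OF p] by blast
  have fc: "f x \<in> carrier G" if "x \<in> carrier G" for x using that f by (auto simp: hom_def)
  have step: "(f ^^ k) (h i) \<in> carrier G \<and> (p ^^ k) i < m \<and>
      (ab ((f ^^ k) (h i)) = ab (h ((p ^^ k) i)) \<or> ab ((f ^^ k) (h i)) = - ab (h ((p ^^ k) i)))"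
    if "i < m" for k i
  proof (induction k)
    case 0
    then show ?case using that h by simp
  next
    case (Suc k)
    let ?x = "(f ^^ k) (h i)" and ?i = "(p ^^ k) i"
    have x: "?x \<in> carrier G" "?i < m" "ab ?x = ab (h ?i) \<or> ab ?x = - ab (h ?i)" using Suc by auto
    have "ab (f ?x) = ab (f (h ?i)) \<or> ab (f ?x) = - ab (f (h ?i))"
      using x(3) hom_ab_cong[OF f x(1) h[OF x(2)]] neg[OF f x(1) h[OF x(2)]] by blast
    then have "ab (f ?x) = ab (h (p ?i)) \<or> ab (f ?x) = - ab (h (p ?i))"
      using perm[OF x(2)] by (elim disjE) simp_all
    moreover have "p ?i < m" using p x(2) by (auto simp: bij_betw_def)
    ultimately show ?case using fc[OF x(1)] by simp
  qed
  have "ab ((f ^^ (n + n)) (h i)) = ab (h i)" if i: "i < m" for i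
  proof -
    let ?x = "(f ^^ n) (h i)"
    have x: "?x \<in> carrier G" "ab ?x = ab (h i) \<or> ab ?x = - ab (h i)"
      using step[OF i, of n] n(1)[OF i] by auto
    have "(f ^^ (n + n)) (h i) = (f ^^ n) ?x" by (simp add: funpow_add)
    then show ?thesis
      using x hom_ab_cong[OF hom_funpow[OF f] x(1) h[OF i]] neg[OF hom_funpow[OF f] x(1) h[OF i]]
      by auto
  qed
  then show ?thesis using n(2) that[of "n + n"] by simp
qed

text \<open>\<open>f\<close> restricts to an automorphism of \<open>H\<close>, being the identity
  both on the kernel of \<open>ab\<close> in \<open>H\<close> and modulo it. The retraction is
  \<open>f\<close> followed by the inverse of that automorphism.\<close>

lemma is_retract_of_hom:
  assumes H: "subgroup H G" and f: "f \<in> hom G G" and im: "f ` carrier G \<subseteq> H"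
    and f_ab: "\<And>x. x \<in> H \<Longrightarrow> ab (f x) = ab x"
    and f_ker: "\<And>x. x \<in> H \<Longrightarrow> ab x = 0 \<Longrightarrow> f x = x"
  shows "is_retract G H"
proof -
  interpret f: group_hom G G f using f by unfold_locales
  have c: "x \<in> carrier G" if "x \<in> H" for x using that subgroup.mem_carrier[OF H] by blast
  note closed = subgroup.m_closed[OF H] subgroup.m_inv_closed[OF H]
  have fH: "f x \<in> H" if "x \<in> H" for x using im c[OF that] by blast
  have inj: "inj_on f H"
  proof (rule inj_onI)
    fix x y assume xy: "x \<in> H" "y \<in> H" "f x = f y"
    then have "ab x = ab y" using f_ab by metis
    then have "f (inv x \<otimes> y) = inv x \<otimes> y"
      using xy c closed by (intro f_ker) (auto simp: ab_mult ab_inv)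
    moreover have "f (inv x \<otimes> y) = \<one>" using xy c by simp
    ultimately have "inv x \<otimes> y = \<one>" by simp
    then show "x = y" using xy c inv_equality[of "inv x" y] by (metis inv_closed inv_inv)
  qed
  have surj: "x \<in> f ` H" if x: "x \<in> H" for x
  proof -
    \<comment> \<open>The error \<open>?u\<close> lies in the kernel of \<open>ab\<close>, so
      \<open>f\<close> fixes it, and \<open>x \<otimes> inv ?u\<close> is a preimage of
      \<open>x\<close>.\<close>
    let ?u = "inv x \<otimes> f x"
    have u: "?u \<in> H" using x fH closed by simp
    moreover have "ab ?u = 0" using x c fH by (simp add: ab_mult ab_inv f_ab)
    ultimately have fu: "f ?u = ?u" by (rule f_ker)
    have "f (x \<otimes> inv ?u) = f x \<otimes> inv ?u" 
      using x u c f.hom_mult[of x "inv ?u"] f.hom_inv[of ?u] fu by simp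
    also have "\<dots> = x" using x c fH by (simp add: inv_mult_group m_assoc[symmetric])
    finally show ?thesis using x u closed by (metis image_eqI)
  qed
  define r where "r x = inv_into H f (f x)" for x
  have r: "r x \<in> H" "f (r x) = f x" if "x \<in> carrier G" for x
    using surj[of "f x"] im that by (auto simp: r_def inv_into_into f_inv_into_f)
  have "r \<in> hom G G"
  proof (rule homI)
    fix x y assume xy: "x \<in> carrier G" "y \<in> carrier G"
    then have "f (r (x \<otimes> y)) = f (r x \<otimes> r y)" using r c by simp
    then show "r (x \<otimes> y) = r x \<otimes> r y"
      using inj xy r closed by (meson inj_onD m_closed)
  qed (use r c in blast)
  moreover have "r x = x" if "x \<in> H" for x using inj that by (simp add: r_def)
  ultimately show ?thesis using r(1) unfolding is_retract_def by blast
qed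

text \<open>Since \<open>f\<close> preserves \<open>ab\<close> on \<open>H\<close>, the change of a
  Fox derivative under \<open>f\<close> is a crossed homomorphism there. A multiple of it, corrected
  by a principal one, vanishes on all \<open>h i\<close> and hence on \<open>H\<close>; the
  correction is zero on the kernel of \<open>ab\<close>.\<close>

lemma hom_fixes_kernel:
  assumes H: "subgroup H G" and f: "f \<in> hom G G" and im: "f ` carrier G \<subseteq> H"
    and f_ab: "\<And>x. x \<in> H \<Longrightarrow> ab (f x) = ab x"
    and h: "\<And>i. i < n \<Longrightarrow> h i \<in> H" and span: "\<And>x. x \<in> H \<Longrightarrow> ab x \<in> lspan (\<lambda>i. ab (h i)) n"
    and ker: "\<And>x. x \<in> H \<Longrightarrow> ab x = 0 \<Longrightarrow> x \<in> derived G H"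
    and "0 < n" "ab (h 0) \<noteq> 0"
    and comm: "\<And>i j. i < n \<Longrightarrow> D (f (h 0 \<otimes> h i \<otimes> inv (h 0) \<otimes> inv (h i))) j
        = D (h 0 \<otimes> h i \<otimes> inv (h 0) \<otimes> inv (h i)) j"
    and x: "x \<in> H" "ab x = 0"
  shows "f x = x"
proof -
  interpret f: group_hom G G f using f by unfold_locales
  have c: "x \<in> carrier G" if "x \<in> H" for x using that subgroup.mem_carrier[OF H] by blast
  have fc: "f x \<in> carrier G" if "x \<in> H" for x using c[OF that] by simp
  \<comment> \<open>By the commutator formula, \<open>d j (h i)\<close> is minus the change under
    \<open>f\<close> of the \<open>j\<close>-th Fox derivative of the commutator of
    \<open>h 0\<close> and \<open>h i\<close>.\<close>
  define d where "d j x = (1 - mon (ab (h 0))) * (D (f x) j - D x j)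
      - (1 - mon (ab x)) * (D (f (h 0)) j - D (h 0) j)" for j x
  have "d j x = 0" for j
  proof (rule cocycle_eq_zero[OF ab H _ h _ span ker])
    show "cocycle ab H (d j)"
      unfolding cocycle_def
      by (simp add: d_def D_mult ab_mult f_ab c fc mon_mult[symmetric] algebra_simps)
    show "d j (h i) = 0" if "i < n" for i
      using comm[OF that, of j] h[OF that] h[OF \<open>0 < n\<close>] c
      by (simp add: D_commutator f_ab d_def algebra_simps)
  qed (use x in auto)
  then have "(1 - mon (ab (h 0))) * (D (f x) j - D x j) = 0" for j
    using x by (simp add: d_def)
  moreover have "1 - mon (ab (h 0)) \<noteq> 0"
    using \<open>ab (h 0) \<noteq> 0\<close> by (simp add: one_minus_mon_eq_0_iff del: right_minus_eq)
  ultimately have "D (f x) j = D x j" for j by (metis mult_eq_0_iff right_minus_eq)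
  then show ?thesis using x c fc f_ab by (intro fox_eqI) auto
qed

text \<open>Verbal closedness enters only through \<open>fixing\<close>. The \<open>l\<close>
  elements that can be fixed at once are spent on the \<open>l\<close> commutators of
  \<open>h 0\<close> with the remaining \<open>h i\<close>, which is why \<open>Suc l\<close>
  generators can be handled.\<close>

theorem is_retract_of_fixing_homs:
  assumes H: "subgroup H G" and "l \<ge> 1"
    and fixing: "\<And>k. (\<And>i. i < l \<Longrightarrow> k i \<in> H) \<Longrightarrow>
      \<exists>f\<in>hom G G. f ` carrier G \<subseteq> H \<and> (\<forall>i<l. f (k i) = k i)"
    and h: "\<And>i. i < Suc l \<Longrightarrow> h i \<in> H"
    and span: "\<And>x. x \<in> H \<Longrightarrow> ab x \<in> lspan (\<lambda>i. ab (h i)) (Suc l)"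
    and indep: "lindep (\<lambda>i. ab (h i)) (Suc l)"
  shows "is_retract G H"
proof -
  have c: "x \<in> carrier G" if "x \<in> H" for x using that subgroup.mem_carrier[OF H] by blast
  have hc: "h i \<in> carrier G" if "i < Suc l" for i using h c that by blast
  \<comment> \<open>An endomorphism \<open>f\<close> into \<open>H\<close> that fixes
    \<open>x\<close> maps the derived subgroup of \<open>G\<close>, which contains \<open>x\<close>,
    into that of \<open>H\<close>.\<close>
  have ker: "x \<in> derived G H" if x: "x \<in> H" "ab x = 0" for x
  proof -
    obtain f where f: "f \<in> hom G G" "f ` carrier G \<subseteq> H" "f x = x"
      using fixing[of "\<lambda>_. x"] x \<open>l \<ge> 1\<close> by force
    interpret f: group_hom G G f using f(1) by unfold_locales
    have "f x \<in> f ` derived G (carrier G)" using ab_kernel x c by blast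
    also have "\<dots> = derived G (f ` carrier G)" by (rule f.derived_img[symmetric]) simp
    also have "\<dots> \<subseteq> derived G H" using f(2) subgroup.subset[OF H] by (intro mono_derived)
    finally show ?thesis using f(3) by simp
  qed
  define w where "w i = h 0 \<otimes> h i \<otimes> inv (h 0) \<otimes> inv (h i)" for i
  have wH: "w i \<in> H" if "i < Suc l" for i
    using h that subgroup.m_closed[OF H] subgroup.m_inv_closed[OF H] by (auto simp: w_def)
  have ab_w: "ab (w i) = 0" if "i < Suc l" for i
    using hc that by (simp add: w_def ab_mult ab_inv)
  obtain j0 where j0: "D (w 1) j0 \<noteq> 0"
    using commutator_fox_nonzero[OF indep, of 0 1 "h 0" "h 1"] hc \<open>l \<ge> 1\<close> by (auto simp: w_def)
  obtain N where N: "\<And>b v. (\<And>i. i < Suc l \<Longrightarrow> b i \<in> lspan (\<lambda>i. ab (h i)) (Suc l)) \<Longrightarrow>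
      (\<Prod>i<Suc l. 1 - mon (b i)) ^ N * v = (\<Prod>i<Suc l. 1 - mon (ab (h i))) ^ N * D (w 1) j0 \<Longrightarrow>
      \<exists>p. bij_betw p {..<Suc l} {..<Suc l} \<and>
          (\<forall>i<Suc l. b i = ab (h (p i)) \<or> b i = - ab (h (p i)))"
    using signed_permutation_of_divisibility[OF indep j0] by blast
  \<comment> \<open>Twisting along \<open>N\<close> copies of the list of all \<open>h i\<close>
    multiplies Fox derivatives by the \<open>N\<close>-th power of the product of the
    \<open>1 - mon (ab (h i))\<close>.\<close>
  define xs where "xs = concat (replicate N (map h [0..<Suc l]))"
  have xs: "set xs \<subseteq> H" using h by (auto simp: xs_def)
  have prod_xs: "(\<Prod>x\<leftarrow>map g xs. 1 - mon (ab x)) = (\<Prod>i<Suc l. 1 - mon (ab (g (h i)))) ^ N" for g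
  proof -
    have "(\<Prod>x\<leftarrow>map g (concat (replicate n (map h [0..<Suc l]))). 1 - mon (ab x))
        = (\<Prod>i<Suc l. 1 - mon (ab (g (h i)))) ^ n" for n
    proof (induction n)
      case (Suc n)
      have "(\<Prod>x\<leftarrow>map g (map h [0..<Suc l]). 1 - mon (ab x)) = (\<Prod>i<Suc l. 1 - mon (ab (g (h i))))"
        by (simp add: prod.distinct_set_conv_list[symmetric] atLeast0LessThan del: upt_Suc)
      then show ?case using Suc by (simp del: upt_Suc prod.lessThan_Suc)
    qed simp
    then show ?thesis by (simp add: xs_def)
  qed
  define k where "k i = foldr twist xs (w (Suc i))" for i
  have kH: "k i \<in> H" if "i < l" for i
    unfolding k_def using that wH xs by (intro foldr_twist_closed[OF H]) auto
  obtain f where f: "f \<in> hom G G" "f ` carrier G \<subseteq> H" "\<And>i. i < l \<Longrightarrow> f (k i) = k i"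
    using fixing[of k] kH by blast
  have xsc: "set xs \<subseteq> carrier G" using xs c by blast
  \<comment> \<open>Stated for every endomorphism \<open>g\<close>, as it is applied to the
    identity, to \<open>f\<close> and to the power \<open>s\<close> of \<open>f\<close>.\<close>
  have D_k: "D (g (k i)) j = (\<Prod>i<Suc l. 1 - mon (ab (g (h i)))) ^ N * D (g (w (Suc i))) j"
    if g: "g \<in> hom G G" and i: "i < l" for g i j
  proof -
    interpret g: group_hom G G g using g by unfold_locales
    have wc: "w (Suc i) \<in> carrier G" using wH c i by simp
    have "ab (g (w (Suc i))) = 0"
      using hc i by (simp add: w_def ab_mult ab_inv)
    moreover have "set (map g xs) \<subseteq> carrier G" using xsc by auto
    ultimately show ?thesis
      unfolding k_def hom_foldr_twist[OF g xsc wc] prod_xs[symmetric]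
      using cocycle_foldr_twist[OF ab D[of j], of "map g xs" "g (w (Suc i))"] wc by simp
  qed
  have id: "(\<lambda>x. x) \<in> hom G G" by (simp add: hom_def)
  \<comment> \<open>The equation \<open>f (k 0) = k 0\<close>, read in the coordinate
    \<open>j0\<close>, is the divisibility required by the choice of \<open>N\<close>, with
    \<open>v = D (f (w 1)) j0\<close>.\<close>
  obtain p where p: "bij_betw p {..<Suc l} {..<Suc l}"
    "\<And>i. i < Suc l \<Longrightarrow> ab (f (h i)) = ab (h (p i)) \<or> ab (f (h i)) = - ab (h (p i))"
  proof -
    have "(\<Prod>i<Suc l. 1 - mon (ab (f (h i)))) ^ N * D (f (w 1)) j0
        = (\<Prod>i<Suc l. 1 - mon (ab (h i))) ^ N * D (w 1) j0"
      using D_k[OF f(1), of 0 j0] D_k[OF id, of 0 j0] f(3)[of 0] \<open>l \<ge> 1\<close> by simp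
    moreover have "ab (f (h i)) \<in> lspan (\<lambda>i. ab (h i)) (Suc l)" if "i < Suc l" for i
      using f(2) hc[OF that] span by blast
    ultimately show ?thesis using N[of "\<lambda>i. ab (f (h i))"] that by blast
  qed
  obtain n where n: "n > 0" "\<And>i. i < Suc l \<Longrightarrow> ab ((f ^^ n) (h i)) = ab (h i)"
    using hom_power_ab_id[where h = h and p = p and m = "Suc l", OF f(1) hc p] by blast
  define s where "s = f ^^ n"
  have s: "s \<in> hom G G" unfolding s_def by (rule hom_funpow[OF f(1)])
  \<comment> \<open>Positivity of \<open>n\<close> matters: the outermost application of
    \<open>f\<close> lands in \<open>H\<close>.\<close>
  have im: "s ` carrier G \<subseteq> H"
  proof -
    obtain n' where "n = Suc n'" using n(1) by (cases n) auto
    moreover have "(f ^^ n') x \<in> carrier G" if "x \<in> carrier G" for x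
      using hom_funpow[OF f(1)] that by (auto simp: hom_def)
    ultimately show ?thesis using f(2) by (auto simp: s_def)
  qed
  have s_ab: "ab (s x) = ab x" if "x \<in> H" for x
    using hom_ab_eq_on[OF s hc _ c[OF that] span[OF that]] n(2) by (simp add: s_def)
  have s_k: "s (k i) = k i" if "i < l" for i
    unfolding s_def by (induction n) (auto simp: f(3)[OF that])
  let ?P = "(\<Prod>i<Suc l. 1 - mon (ab (h i)))"
  have P: "?P \<noteq> 0"
    using lindep_nonzero[OF indep] by (subst prod_zero_iff) (auto simp: one_minus_mon_eq_0_iff simp del: right_minus_eq)
  \<comment> \<open>\<open>s\<close> fixes \<open>k\<close> and does not change the factors
    \<open>1 - mon (ab (h i))\<close>, so the common nonzero power \<open>?P ^ N\<close>
    cancels.\<close>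
  have s_w: "D (s (w i)) j = D (w i) j" if i: "i < Suc l" for i j
  proof (cases i)
    case 0
    have "w 0 = \<one>" using hc[of 0] by (simp add: w_def m_assoc)
    moreover have "s \<one> = \<one>" using s by (simp add: hom_one is_group)
    ultimately show ?thesis using 0 by simp
  next
    case (Suc i')
    have "(\<Prod>i<Suc l. 1 - mon (ab (s (h i)))) = ?P"
      using s_ab h by (intro prod.cong) auto
    then have "?P ^ N * D (s (w i)) j = ?P ^ N * D (w i) j"
      using D_k[OF s, of i' j] D_k[OF id, of i' j] s_k[of i'] i unfolding Suc
      by (metis Suc_less_eq)
    then show ?thesis using P by simp
  qed
  have "s x = x" if x: "x \<in> H" "ab x = 0" for x
  proof (rule hom_fixes_kernel[where h = h and n = "Suc l", OF H s im s_ab h span ker _ _ _ x])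
    show "ab (h 0) \<noteq> 0" using lindep_nonzero[OF indep, of 0] by simp
    show "D (s (h 0 \<otimes> h i \<otimes> inv (h 0) \<otimes> inv (h i))) j = D (h 0 \<otimes> h i \<otimes> inv (h 0) \<otimes> inv (h i)) j"
      if "i < Suc l" for i j
      using s_w[OF that, of j] unfolding w_def .
  qed auto
  then show ?thesis using is_retract_of_hom[OF H s im s_ab] by blast
qed

end

section \<open>Free groups and free metabelian groups\<close>

text \<open>The index type is arbitrary because words in generators and words in edges of a Cayley
  graph are both evaluated.\<close>

definition letter_eval :: "('a, 'b) monoid_scheme \<Rightarrow> ('x \<Rightarrow> 'a) \<Rightarrow> bool \<times> 'x \<Rightarrow> 'a" where
  "letter_eval G y a = (if fst a then y (snd a) else inv\<^bsub>G\<^esub> y (snd a))"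

fun list_eval :: "('a, 'b) monoid_scheme \<Rightarrow> ('x \<Rightarrow> 'a) \<Rightarrow> (bool \<times> 'x) list \<Rightarrow> 'a" where
  "list_eval G y [] = \<one>\<^bsub>G\<^esub>"
| "list_eval G y (a # w) = letter_eval G y a \<otimes>\<^bsub>G\<^esub> list_eval G y w"

lemma (in group) letter_eval_in_subgroup:
  assumes "subgroup K G" "y (snd a) \<in> K"
  shows "letter_eval G y a \<in> K"
  using assms by (simp add: letter_eval_def subgroup.m_inv_closed)

lemma (in group) list_eval_in_subgroup:
  assumes "subgroup K G" "\<And>a. a \<in> set w \<Longrightarrow> y (snd a) \<in> K"
  shows "list_eval G y w \<in> K"
  using assms(2)
  by (induction w) (auto simp: subgroup.one_closed[OF assms(1)] subgroup.m_closed[OF assms(1)]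
      letter_eval_in_subgroup[OF assms(1)])

lemmas (in group) list_eval_closed = list_eval_in_subgroup[OF subgroup_self]
  and letter_eval_closed = letter_eval_in_subgroup[OF subgroup_self]

lemma (in group) list_eval_append:
  assumes "\<And>a. a \<in> set v \<union> set w \<Longrightarrow> y (snd a) \<in> carrier G"
  shows "list_eval G y (v @ w) = list_eval G y v \<otimes> list_eval G y w"
  using assms
  by (induction v) (auto simp: list_eval_closed letter_eval_closed m_assoc)

lemma list_eval_cong:
  "(\<And>a. a \<in> set w \<Longrightarrow> y (snd a) = z (snd a)) \<Longrightarrow> list_eval G y w = list_eval G z w"
  by (induction w) (auto simp: letter_eval_def)

lemma (in group_hom) hom_list_eval:
  assumes "\<And>a. a \<in> set w \<Longrightarrow> y (snd a) \<in> carrier G"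
  shows "h (list_eval G y w) = list_eval H (\<lambda>i. h (y i)) w"
  using assms
  by (induction w) (auto simp: letter_eval_def G.list_eval_closed)

definition signed_count :: "(bool \<times> 'x) list \<Rightarrow> 'x \<Rightarrow> int" where
  "signed_count w z = (\<Sum>a\<leftarrow>w. if snd a = z then (if fst a then 1 else - 1) else 0)"

lemma signed_count_simps [simp]:
  "signed_count [] z = 0"
  "signed_count (a # w) z = (if snd a = z then (if fst a then 1 else - 1) else 0) + signed_count w z"
  "signed_count (v @ w) z = signed_count v z + signed_count w z"
  by (simp_all add: signed_count_def)

text \<open>A zero signed count forces the inverse of the first letter to occur later. By
  commutativity the two cancel, and the shorter word still has zero counts.\<close>

lemma (in comm_group) list_eval_eq_one:
  assumes "\<And>a. a \<in> set w \<Longrightarrow> y (snd a) \<in> carrier G" "\<And>z. signed_count w z = 0"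
  shows "list_eval G y w = \<one>"
  using assms
proof (induction w rule: length_induct)
  case (1 w)
  show ?case
  proof (cases w)
    case (Cons a w')
    have "(\<not> fst a, snd a) \<in> set w'"
    proof (rule ccontr)
      assume "(\<not> fst a, snd a) \<notin> set w'"
      then have "if fst a then signed_count w' (snd a) \<ge> 0 else signed_count w' (snd a) \<le> 0"
        by (induction w') auto
      then show False using 1(3)[of "snd a"] by (auto simp: Cons split: if_splits)
    qed
    then obtain u v where w': "w' = u @ (\<not> fst a, snd a) # v" by (meson split_list)
    have c: "list_eval G y u \<in> carrier G" "list_eval G y v \<in> carrier G" "y (snd a) \<in> carrier G"
      using 1(2) by (auto simp: Cons w' intro!: list_eval_closed)
    have "list_eval G y (u @ v) = \<one>"
    proof (rule 1(1)[rule_format])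
      show "signed_count (u @ v) z = 0" for z
        using 1(3)[of z] by (auto simp: Cons w' split: if_splits)
    qed (use 1(2) in \<open>auto simp: Cons w'\<close>)
    then have uv: "list_eval G y u \<otimes> list_eval G y v = \<one>"
      using 1(2) by (subst (asm) list_eval_append) (auto simp: Cons w')
    let ?a = "letter_eval G y a" and ?b = "letter_eval G y (\<not> fst a, snd a)"
    have ab: "?a \<otimes> ?b = \<one>" "?a \<in> carrier G" "?b \<in> carrier G"
      using c by (auto simp: letter_eval_def)
    have "list_eval G y w = ?a \<otimes> (list_eval G y u \<otimes> (?b \<otimes> list_eval G y v))"
      using 1(2) by (simp add: Cons w') (subst list_eval_append, auto simp: Cons w')
    also have "\<dots> = (?a \<otimes> ?b) \<otimes> (list_eval G y u \<otimes> list_eval G y v)"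
      using c ab(2,3) by (simp add: m_ac)
    finally show ?thesis using uv ab by simp
  qed simp
qed

section \<open>Free reduction and the group structure on reduced words\<close>

lemma freely_reduced_simps [simp]:
  "freely_reduced []"
  "freely_reduced [a]"
  "freely_reduced (a # b # w) \<longleftrightarrow> \<not> (fst a \<noteq> fst b \<and> snd a = snd b) \<and> freely_reduced (b # w)"
proof -
  show "freely_reduced []" "freely_reduced [a]" by (auto simp: freely_reduced_def)
  have split: "(\<forall>i. Q i) \<longleftrightarrow> Q 0 \<and> (\<forall>i. Q (Suc i))" for Q :: "nat \<Rightarrow> bool"
    by (metis not0_implies_Suc)
  show "freely_reduced (a # b # w) \<longleftrightarrow> \<not> (fst a \<noteq> fst b \<and> snd a = snd b) \<and> freely_reduced (b # w)"
    unfolding freely_reduced_def by (subst split) simp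
qed

lemma freely_reduced_tl: "freely_reduced (a # w) \<Longrightarrow> freely_reduced w"
  by (cases w) auto

lemma freely_reduced_cancel_step: "freely_reduced w \<Longrightarrow> freely_reduced (cancel_step a w)"
  by (cases w) (auto simp: cancel_step_def dest: freely_reduced_tl)

lemma freely_reduced_foldr_cancel_step:
  "freely_reduced w \<Longrightarrow> freely_reduced (foldr cancel_step v w)"
  by (induction v) (auto simp: freely_reduced_cancel_step)

lemma freely_reduced_free_reduce: "freely_reduced (free_reduce w)"
  by (simp add: free_reduce_def freely_reduced_foldr_cancel_step)

lemma set_cancel_step: "set (cancel_step a w) \<subseteq> insert a (set w)"
  by (cases w) (auto simp: cancel_step_def)

lemma set_free_reduce: "set (free_reduce w) \<subseteq> set w"
  unfolding free_reduce_def by (induction w) (use set_cancel_step in fastforce)+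

lemma free_reduce_id: "freely_reduced w \<Longrightarrow> free_reduce w = w"
proof (induction w)
  case (Cons a w)
  then have "free_reduce w = w" using freely_reduced_tl by blast
  then have "free_reduce (a # w) = cancel_step a w" by (simp add: free_reduce_def)
  also have "\<dots> = a # w" using Cons.prems by (cases w) (auto simp: cancel_step_def)
  finally show ?case .
qed (simp add: free_reduce_def)

text \<open>Letters act on reduced words by permutations, as in van der Waerden's proof of
  associativity. If \<open>b\<close> removes the head \<open>a\<close> of \<open>w\<close>,
  reducedness ensures that \<open>a\<close>, put back, does not cancel against the next
  letter.\<close>

lemma cancel_step_inverse:
  assumes "freely_reduced w" "fst b \<noteq> fst a" "snd b = snd a"
  shows "cancel_step a (cancel_step b w) = w"
proof (cases w)
  case (Cons c v)
  show ?thesis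
  proof (cases "fst c \<noteq> fst b \<and> snd c = snd b")
    case True
    then have "c = a" using assms by (simp add: prod_eq_iff)
    then show ?thesis using assms True Cons
      by (cases v) (auto simp: cancel_step_def)
  qed (use assms Cons in \<open>auto simp: cancel_step_def\<close>)
qed (use assms in \<open>auto simp: cancel_step_def\<close>)

text \<open>If \<open>a\<close> cancels the head \<open>b\<close> of \<open>v\<close>, the actions
  of \<open>a\<close> and \<open>b\<close> on a reduced word cancel as well.\<close>

lemma foldr_cancel_step_cancel_step:
  assumes "freely_reduced w"
  shows "foldr cancel_step (cancel_step a v) w = cancel_step a (foldr cancel_step v w)"
proof (cases v)
  case (Cons b u)
  then show ?thesis
    using cancel_step_inverse[OF freely_reduced_foldr_cancel_step[OF assms], of b a u]
    by (auto simp: cancel_step_def[of a "b # u"])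
qed (simp add: cancel_step_def)

lemma foldr_cancel_step_free_reduce:
  "freely_reduced w \<Longrightarrow> foldr cancel_step (free_reduce v) w = foldr cancel_step v w"
proof (induction v)
  case (Cons a v)
  then show ?case
    using foldr_cancel_step_cancel_step[OF Cons.prems, of a "free_reduce v"] by (simp add: free_reduce_def)
qed (simp add: free_reduce_def)

lemma free_reduce_append: "free_reduce (v @ w) = foldr cancel_step v (free_reduce w)"
  by (simp add: free_reduce_def)

lemma free_reduce_append_left: "free_reduce (free_reduce v @ w) = free_reduce (v @ w)"
  unfolding free_reduce_append by (rule foldr_cancel_step_free_reduce[OF freely_reduced_free_reduce])

lemma free_reduce_append_right: "free_reduce (v @ free_reduce w) = free_reduce (v @ w)"
  by (simp add: free_reduce_append free_reduce_id freely_reduced_free_reduce)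

definition inverse_word :: "(bool \<times> nat) list \<Rightarrow> (bool \<times> nat) list" where
  "inverse_word w = rev (map (\<lambda>a. (\<not> fst a, snd a)) w)"

lemma free_reduce_inverse_word: "free_reduce (inverse_word w @ w) = []"
proof (induction w)
  case (Cons a w)
  have "cancel_step (\<not> fst a, snd a) (cancel_step a (free_reduce w)) = free_reduce w"
    by (rule cancel_step_inverse[OF freely_reduced_free_reduce]) auto
  then have "free_reduce (inverse_word (a # w) @ a # w) = free_reduce (inverse_word w @ w)"
    by (simp add: inverse_word_def free_reduce_def)
  then show ?case using Cons by simp
qed (simp add: inverse_word_def free_reduce_def)

lemma free_group_simps:
  "carrier (free_group r) = {w. freely_reduced w \<and> (\<forall>a\<in>set w. snd a < r)}"
  "x \<otimes>\<^bsub>free_group r\<^esub> y = free_reduce (x @ y)"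
  "\<one>\<^bsub>free_group r\<^esub> = []"
  by (simp_all add: free_group_def)

lemma free_reduce_in_free_group:
  assumes "\<forall>a\<in>set w. snd a < r"
  shows "free_reduce w \<in> carrier (free_group r)"
  using assms set_free_reduce[of w] by (auto simp: free_group_simps freely_reduced_free_reduce)

lemma group_free_group: "group (free_group r)"
proof (rule groupI)
  fix x y z assume x: "x \<in> carrier (free_group r)" and y: "y \<in> carrier (free_group r)"
  then show "x \<otimes>\<^bsub>free_group r\<^esub> y \<in> carrier (free_group r)"
    unfolding free_group_simps(2) by (intro free_reduce_in_free_group) (auto simp: free_group_simps)
  show "x \<otimes>\<^bsub>free_group r\<^esub> y \<otimes>\<^bsub>free_group r\<^esub> z
      = x \<otimes>\<^bsub>free_group r\<^esub> (y \<otimes>\<^bsub>free_group r\<^esub> z)"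
    by (simp add: free_group_simps free_reduce_append_left free_reduce_append_right)
next
  fix x assume x: "x \<in> carrier (free_group r)"
  have "free_reduce (inverse_word x) \<in> carrier (free_group r)"
    using x by (intro free_reduce_in_free_group) (auto simp: free_group_simps inverse_word_def)
  moreover have "free_reduce (inverse_word x) \<otimes>\<^bsub>free_group r\<^esub> x = \<one>\<^bsub>free_group r\<^esub>"
    by (simp add: free_group_simps free_reduce_append_left free_reduce_inverse_word)
  ultimately show "\<exists>y\<in>carrier (free_group r). y \<otimes>\<^bsub>free_group r\<^esub> x = \<one>\<^bsub>free_group r\<^esub>" by blast
qed (auto simp: free_group_simps free_reduce_id)

lemma (in group) list_eval_cancel_step:
  assumes "\<And>b. b \<in> insert a (set w) \<Longrightarrow> y (snd b) \<in> carrier G"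
  shows "list_eval G y (cancel_step a w) = letter_eval G y a \<otimes> list_eval G y w"
proof (cases w)
  case (Cons b v)
  have c: "list_eval G y v \<in> carrier G" using assms Cons by (intro list_eval_closed) auto
  have ab: "y (snd a) \<in> carrier G" "y (snd b) \<in> carrier G" using assms Cons by auto
  show ?thesis
    using c ab by (auto simp: Cons cancel_step_def letter_eval_def m_assoc[symmetric])
qed (use assms in \<open>simp add: cancel_step_def\<close>)

lemma (in group) list_eval_free_reduce:
  assumes "\<And>a. a \<in> set w \<Longrightarrow> y (snd a) \<in> carrier G"
  shows "list_eval G y (free_reduce w) = list_eval G y w"
  using assms
proof (induction w)
  case (Cons a w)
  have "list_eval G y (free_reduce (a # w)) = letter_eval G y a \<otimes> list_eval G y (free_reduce w)"
    using set_free_reduce[of w] Cons.prems unfolding free_reduce_def foldr.simps o_apply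
    by (intro list_eval_cancel_step) (auto simp: subset_iff)
  then show ?case using Cons by simp
qed (simp add: free_reduce_def)

lemma (in group) list_eval_hom:
  assumes "\<And>i. i < r \<Longrightarrow> y i \<in> carrier G"
  shows "list_eval G y \<in> hom (free_group r) G"
proof (rule homI)
  fix v w assume vw: "v \<in> carrier (free_group r)" "w \<in> carrier (free_group r)"
  then have y: "y (snd a) \<in> carrier G" if "a \<in> set v \<union> set w" for a
    using that assms by (auto simp: free_group_simps)
  then show "list_eval G y (v \<otimes>\<^bsub>free_group r\<^esub> w) = list_eval G y v \<otimes> list_eval G y w"
    unfolding free_group_simps using list_eval_free_reduce[of "v @ w" y] list_eval_append[of v w y]
    by simp
qed (use assms in \<open>auto simp: free_group_simps intro!: list_eval_closed\<close>)

lemma list_eval_free_group: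
  assumes "\<forall>a\<in>set w. snd a < r"
  shows "list_eval (free_group r) (\<lambda>i. [(True, i)]) w = free_reduce w"
  using assms
proof (induction w)
  case (Cons a w)
  interpret F: group "free_group r" by (rule group_free_group)
  have "inv\<^bsub>free_group r\<^esub> [(True, i)] = [(False, i)]" if "i < r" for i
    using that by (intro F.inv_equality) (auto simp: free_group_simps free_reduce_def cancel_step_def)
  then have "letter_eval (free_group r) (\<lambda>i. [(True, i)]) a = [a]"
    using Cons.prems by (cases a) (auto simp: letter_eval_def)
  then show ?case using Cons free_reduce_append_right[of "[a]" w] by (simp add: free_group_simps)
qed (simp add: free_group_simps free_reduce_def)

section \<open>The free metabelian group and its universal property\<close>

definition generator :: "nat \<Rightarrow> nat \<Rightarrow> (bool \<times> nat) list set" where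
  "generator r i = derived (free_group r) (derived (free_group r) (carrier (free_group r)))
     #>\<^bsub>free_group r\<^esub> [(True, i)]"

context
  fixes r :: nat
begin

interpretation F: group "free_group r" by (rule group_free_group)

abbreviation (input) "second_derived \<equiv> derived (free_group r) (derived (free_group r) (carrier (free_group r)))"

lemma second_derived_normal: "second_derived \<lhd> free_group r"
  by (intro F.derived_is_normal F.derived_self_is_normal)

lemma group_free_metabelian: "group (free_metabelian r)"
  unfolding free_metabelian_def by (rule normal.factorgroup_is_group[OF second_derived_normal])

lemma free_metabelian_proj_hom: "(\<lambda>w. second_derived #>\<^bsub>free_group r\<^esub> w) \<in> hom (free_group r) (free_metabelian r)"
  unfolding free_metabelian_def by (rule normal.r_coset_hom_Mod[OF second_derived_normal])

lemma free_metabelian_proj_group_hom: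
  "group_hom (free_group r) (free_metabelian r) (\<lambda>w. second_derived #>\<^bsub>free_group r\<^esub> w)"
  by (intro group_hom.intro group_hom_axioms.intro group_free_group group_free_metabelian
      free_metabelian_proj_hom)

lemma carrier_free_metabelian:
  "carrier (free_metabelian r) = (\<lambda>w. second_derived #>\<^bsub>free_group r\<^esub> w) ` carrier (free_group r)"
  unfolding free_metabelian_def by (rule carrier_FactGroup)

lemma letter_in_free_group: "i < r \<Longrightarrow> [(True, i)] \<in> carrier (free_group r)"
  by (simp add: free_group_simps)

lemma generator_closed: "i < r \<Longrightarrow> generator r i \<in> carrier (free_metabelian r)"
  by (auto simp: carrier_free_metabelian generator_def letter_in_free_group)

lemma free_metabelian_elem:
  assumes "x \<in> carrier (free_metabelian r)"
  obtains w where "\<forall>a\<in>set w. snd a < r" "x = list_eval (free_metabelian r) (generator r) w"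
proof -
  interpret P: group_hom "free_group r" "free_metabelian r" "\<lambda>w. second_derived #>\<^bsub>free_group r\<^esub> w"
    by (rule free_metabelian_proj_group_hom)
  obtain w where w: "w \<in> carrier (free_group r)" "x = second_derived #>\<^bsub>free_group r\<^esub> w"
    using assms by (auto simp: carrier_free_metabelian)
  then have r: "\<forall>a\<in>set w. snd a < r" "freely_reduced w" by (auto simp: free_group_simps)
  have "x = second_derived #>\<^bsub>free_group r\<^esub> list_eval (free_group r) (\<lambda>i. [(True, i)]) w"
    using w r by (simp add: list_eval_free_group free_reduce_id)
  also have "\<dots> = list_eval (free_metabelian r) (\<lambda>i. second_derived #>\<^bsub>free_group r\<^esub> [(True, i)]) w"
    using r by (intro P.hom_list_eval letter_in_free_group) auto
  finally have "x = list_eval (free_metabelian r) (generator r) w"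
    by (simp add: generator_def[abs_def])
  then show ?thesis using r that by blast
qed

lemma free_metabelian_second_derived:
  "derived (free_metabelian r) (derived (free_metabelian r) (carrier (free_metabelian r)))
     = {\<one>\<^bsub>free_metabelian r\<^esub>}"
proof -
  interpret P: group_hom "free_group r" "free_metabelian r" "\<lambda>w. second_derived #>\<^bsub>free_group r\<^esub> w"
    by (rule free_metabelian_proj_group_hom)
  have sub: "derived (free_group r) (carrier (free_group r)) \<subseteq> carrier (free_group r)"
    by (intro F.derived_in_carrier subset_refl)
  have "derived (free_metabelian r) (derived (free_metabelian r) (carrier (free_metabelian r)))
      = (\<lambda>w. second_derived #>\<^bsub>free_group r\<^esub> w) ` second_derived"
    unfolding carrier_free_metabelian using sub by (simp add: P.derived_img)
  also have "\<dots> = (\<lambda>w. second_derived) ` second_derived"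
    using normal_imp_subgroup[OF second_derived_normal] subgroup.subset[OF normal_imp_subgroup[OF second_derived_normal]]
    by (intro image_cong refl F.coset_join2) auto
  also have "\<dots> = {second_derived}"
    using subgroup.one_closed[OF normal_imp_subgroup[OF second_derived_normal]] by blast
  finally show ?thesis by (simp add: free_metabelian_def)
qed

text \<open>Evaluation of words at \<open>y\<close> maps the second derived subgroup into that of
  \<open>G\<close>, which is trivial, so it factors through the quotient.\<close>

lemma free_metabelian_universal:
  assumes G: "group G" and metab: "derived G (derived G (carrier G)) \<subseteq> {\<one>\<^bsub>G\<^esub>}"
    and y: "\<And>i. i < r \<Longrightarrow> y i \<in> carrier G"
  obtains f where "f \<in> hom (free_metabelian r) G" "\<And>i. i < r \<Longrightarrow> f (generator r i) = y i"
proof -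
  interpret G: group G by (rule G)
  interpret E: group_hom "free_group r" G "list_eval G y"
    by (intro group_hom.intro group_hom_axioms.intro group_free_group G G.list_eval_hom y)
  let ?D = "derived (free_group r) (carrier (free_group r))"
  have sub: "?D \<subseteq> carrier (free_group r)"
    by (intro F.derived_in_carrier subset_refl)
  have img: "list_eval G y ` carrier (free_group r) \<subseteq> carrier G" by auto
  have "list_eval G y ` second_derived = derived G (derived G (list_eval G y ` carrier (free_group r)))"
    using sub by (simp add: E.derived_img)
  also have "\<dots> \<subseteq> derived G (derived G (carrier G))"
    by (intro G.mono_derived img)
  also have "\<dots> \<subseteq> {\<one>\<^bsub>G\<^esub>}" by (rule metab)
  finally have "second_derived \<subseteq> kernel (free_group r) G (list_eval G y)"
    using F.derived_in_carrier[OF sub] by (auto simp: kernel_def)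
  then obtain f where f: "f \<in> hom (free_group r Mod second_derived) G"
    "\<And>x. x \<in> carrier (free_group r) \<Longrightarrow> f (second_derived #>\<^bsub>free_group r\<^esub> x) = list_eval G y x"
    using E.FactGroup_universal_kernel[OF second_derived_normal] by blast
  show ?thesis
  proof (rule that)
    show "f \<in> hom (free_metabelian r) G" using f(1) by (simp add: free_metabelian_def)
    show "f (generator r i) = y i" if "i < r" for i
      using f(2)[OF letter_in_free_group[OF that]] y[OF that]
      by (simp add: generator_def letter_eval_def)
  qed
qed

end

section \<open>The Magnus embedding\<close>

text \<open>The semidirect product behind the Magnus embedding: each coordinate \<open>j\<close>
  represents the matrix with rows \<open>(mon a, u j)\<close> and \<open>(0, 1)\<close>. Coordinates
  run over all naturals, independently of the rank.\<close>

definition magnus_group :: "(int poly \<times> (nat \<Rightarrow> laurent)) monoid" where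
  "magnus_group = \<lparr> carrier = UNIV,
     monoid.mult = (\<lambda>x y. (fst x + fst y, \<lambda>j. snd x j + mon (fst x) * snd y j)),
     monoid.one = (0, \<lambda>_. 0) \<rparr>"

lemma magnus_group_simps:
  "carrier magnus_group = UNIV"
  "x \<otimes>\<^bsub>magnus_group\<^esub> y = (fst x + fst y, \<lambda>j. snd x j + mon (fst x) * snd y j)"
  "\<one>\<^bsub>magnus_group\<^esub> = (0, \<lambda>_. 0)"
  by (simp_all add: magnus_group_def)

lemma group_magnus_group: "group magnus_group"
proof (rule groupI)
  fix x y z :: "int poly \<times> (nat \<Rightarrow> laurent)"
  show "x \<otimes>\<^bsub>magnus_group\<^esub> y \<otimes>\<^bsub>magnus_group\<^esub> z = x \<otimes>\<^bsub>magnus_group\<^esub> (y \<otimes>\<^bsub>magnus_group\<^esub> z)"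
    by (simp add: magnus_group_simps algebra_simps mon_mult[symmetric])
next
  fix x :: "int poly \<times> (nat \<Rightarrow> laurent)"
  have "(- fst x, \<lambda>j. - (mon (- fst x) * snd x j)) \<otimes>\<^bsub>magnus_group\<^esub> x = \<one>\<^bsub>magnus_group\<^esub>"
    by (simp add: magnus_group_simps)
  then show "\<exists>y\<in>carrier magnus_group. y \<otimes>\<^bsub>magnus_group\<^esub> x = \<one>\<^bsub>magnus_group\<^esub>"
    unfolding magnus_group_simps(1) by blast
qed (simp_all add: magnus_group_simps)

text \<open>Elements of the derived subgroup have first component 0, and such elements multiply by
  adding their second components.\<close>

lemma magnus_group_metabelian:
  "derived magnus_group (derived magnus_group (carrier magnus_group)) \<subseteq> {\<one>\<^bsub>magnus_group\<^esub>}"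
proof -
  interpret N: group magnus_group by (rule group_magnus_group)
  have fst: "N.additive fst" by (simp add: N.additive_def magnus_group_simps)
  have zero: "fst x = 0" if "x \<in> derived magnus_group (carrier magnus_group)" for x
    using N.additive_derived[OF fst subset_refl that] .
  have "x \<otimes>\<^bsub>magnus_group\<^esub> y \<otimes>\<^bsub>magnus_group\<^esub> inv\<^bsub>magnus_group\<^esub> x \<otimes>\<^bsub>magnus_group\<^esub> inv\<^bsub>magnus_group\<^esub> y
      = \<one>\<^bsub>magnus_group\<^esub>" if "fst x = 0" "fst y = 0" for x y
  proof -
    have c: "x \<otimes>\<^bsub>magnus_group\<^esub> y = y \<otimes>\<^bsub>magnus_group\<^esub> x"
      using that by (simp add: magnus_group_simps add.commute)
    have "y \<in> carrier magnus_group" "x \<in> carrier magnus_group" by (simp_all add: magnus_group_simps)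
    then show ?thesis unfolding c by (simp add: N.m_assoc)
  qed
  then have "derived_set magnus_group (derived magnus_group (carrier magnus_group)) \<subseteq> {\<one>\<^bsub>magnus_group\<^esub>}"
    using zero by auto
  then have "derived magnus_group (derived magnus_group (carrier magnus_group)) \<subseteq> generate magnus_group {\<one>\<^bsub>magnus_group\<^esub>}"
    unfolding derived_def[of _ "derived _ _"] by (rule N.mono_generate)
  then show ?thesis by (simp add: N.generate_one)
qed

text \<open>The signed edges of the path that a word traces from the vertex \<open>a\<close> of the
  Cayley graph. The edge \<open>(a, i)\<close> leads from \<open>a\<close> to
  \<open>a + monom 1 i\<close>, so an inverse letter traverses the edge that starts at its
  endpoint.\<close>

fun edges :: "int poly \<Rightarrow> (bool \<times> nat) list \<Rightarrow> (bool \<times> (int poly \<times> nat)) list" where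
  "edges a [] = []"
| "edges a (l # w) = (if fst l then (True, (a, snd l)) # edges (a + Polynomial.monom 1 (snd l)) w
     else (False, (a - Polynomial.monom 1 (snd l), snd l)) # edges (a - Polynomial.monom 1 (snd l)) w)"

text \<open>Conditions that can be verified on generators of a metabelian group; the axioms of
  \<open>fox_group\<close> are derived from them.\<close>

locale fox_generated = group +
  fixes r :: nat and y :: "nat \<Rightarrow> 'a" and ab :: "'a \<Rightarrow> int poly" and D :: "'a \<Rightarrow> nat \<Rightarrow> laurent"
  assumes y_closed: "i < r \<Longrightarrow> y i \<in> carrier G"
    and generated: "x \<in> carrier G \<Longrightarrow> \<exists>w. (\<forall>a\<in>set w. snd a < r) \<and> x = list_eval G y w"
    and metabelian: "derived G (derived G (carrier G)) \<subseteq> {\<one>}"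
    and additive_ab: "additive ab"
    and cocycle_D: "cocycle ab (carrier G) (\<lambda>x. D x j)"
    and ab_y: "i < r \<Longrightarrow> ab (y i) = Polynomial.monom 1 i"
    and D_y: "i < r \<Longrightarrow> D (y i) j = (if j = i then 1 else 0)"
begin

lemmas ab_hom = additive_mult[OF additive_ab] additive_one[OF additive_ab] additive_inv[OF additive_ab]
  and D_hom = cocycle_mult[OF additive_ab subgroup_self cocycle_D]
    cocycle_one[OF additive_ab subgroup_self cocycle_D]
    cocycle_inv[OF additive_ab subgroup_self cocycle_D]

lemma word_closed: "\<forall>a\<in>set w. snd a < r \<Longrightarrow> list_eval G y w \<in> carrier G"
  by (intro list_eval_closed) (auto simp: y_closed)

lemma letter_closed: "snd a < r \<Longrightarrow> letter_eval G y a \<in> carrier G"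
  by (intro letter_eval_closed) (auto simp: y_closed)

lemma coeff_ab_word:
  assumes "\<forall>a\<in>set w. snd a < r"
  shows "Polynomial.coeff (ab (list_eval G y w)) i = signed_count w i"
  using assms
proof (induction w)
  case (Cons a w)
  then have "ab (list_eval G y (a # w)) = ab (letter_eval G y a) + ab (list_eval G y w)"
    by (simp add: ab_hom word_closed letter_closed)
  then show ?case using Cons by (auto simp: letter_eval_def ab_hom y_closed ab_y)
qed (simp add: ab_hom)

text \<open>The augmentation \<open>moment 0\<close> ignores monomial factors, so it turns the
  crossed homomorphism into a sum over letters that counts the generator \<open>j\<close> with
  sign.\<close>

lemma moment_0_D_word:
  assumes "\<forall>a\<in>set w. snd a < r"
  shows "moment 0 (D (list_eval G y w) j) = of_int (Polynomial.coeff (ab (list_eval G y w)) j)"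
  using assms
proof (induction w)
  case (Cons a w)
  have *: "moment 0 (mon b * u) = moment 0 u" for b u by (simp add: moment_mon_mult)
  have [simp]: "moment 0 1 = 1" using moment_mon[of 0 0] by simp
  have a: "moment 0 (D (letter_eval G y a) j) = of_int (Polynomial.coeff (ab (letter_eval G y a)) j)"
  proof (cases "fst a")
    case True
    then show ?thesis using Cons.prems by (auto simp: letter_eval_def ab_y D_y)
  next
    case False
    then show ?thesis using Cons.prems *[of _ 1]
      by (auto simp: letter_eval_def ab_hom D_hom y_closed ab_y D_y moment_uminus)
  qed
  have "D (list_eval G y (a # w)) j
      = D (letter_eval G y a) j + mon (ab (letter_eval G y a)) * D (list_eval G y w) j"
    using Cons.prems by (simp add: D_hom word_closed letter_closed)
  moreover have "ab (list_eval G y (a # w)) = ab (letter_eval G y a) + ab (list_eval G y w)"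
    using Cons.prems by (simp add: ab_hom word_closed letter_closed)
  ultimately show ?case using Cons a by (simp add: moment_add *)
qed (simp add: ab_hom D_hom)

text \<open>A word for \<open>x\<close> has all exponent sums zero, so it is trivial in the
  commutative quotient by the derived subgroup.\<close>

lemma ab_eq_0_imp_derived:
  assumes x: "x \<in> carrier G" and "ab x = 0"
  shows "x \<in> derived G (carrier G)"
proof -
  let ?N = "derived G (carrier G)"
  interpret N: normal ?N G by (rule derived_self_is_normal)
  interpret Q: comm_group "G Mod ?N" by (rule derived_quot_is_comm_group)
  interpret P: group_hom G "G Mod ?N" "\<lambda>x. ?N #> x"
    using N.r_coset_hom_Mod by unfold_locales
  obtain w where w: "\<forall>a\<in>set w. snd a < r" "x = list_eval G y w" using generated[OF x] by blast
  have "?N #> x = list_eval (G Mod ?N) (\<lambda>i. ?N #> y i) w"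
    unfolding w(2) using w(1) y_closed by (intro P.hom_list_eval) auto
  also have "\<dots> = \<one>\<^bsub>G Mod ?N\<^esub>"
  proof (rule Q.list_eval_eq_one)
    show "signed_count w z = 0" for z
      using coeff_ab_word[OF w(1), of z] assms(2) w(2) by simp
  qed (use w(1) y_closed P.hom_closed in auto)
  finally have "?N #> x = ?N" by simp
  then show ?thesis by (rule coset_join1[OF _ x N.subgroup_axioms])
qed

text \<open>The coefficient of \<open>c\<close> in the \<open>i\<close>-th Fox derivative counts the
  signed traversals of the edge \<open>(c, i)\<close>; starting at \<open>b\<close> instead of 0
  multiplies the derivative by \<open>mon b\<close>.\<close>

lemma signed_count_edges:
  assumes "\<forall>a\<in>set w. snd a < r"
  shows "signed_count (edges b w) (c, i) = lookup (mon b * D (list_eval G y w) i) c"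
  using assms
proof (induction w arbitrary: b)
  case (Cons a w)
  have "D (list_eval G y (a # w)) i
      = D (letter_eval G y a) i + mon (ab (letter_eval G y a)) * D (list_eval G y w) i"
    using Cons.prems by (simp add: D_hom word_closed letter_closed)
  then have *: "lookup (mon b * D (list_eval G y (a # w)) i) c = lookup (mon b * D (letter_eval G y a) i) c
      + lookup (mon (b + ab (letter_eval G y a)) * D (list_eval G y w) i) c"
    by (simp add: distrib_left lookup_add mon_mult[symmetric] mult.assoc)
  show ?case
  proof (cases "fst a")
    case True
    then have "lookup (mon b * D (letter_eval G y a) i) c = (if (b, snd a) = (c, i) then 1 else 0)"
      using Cons.prems by (auto simp: letter_eval_def D_y lookup_single when_def)
    moreover have "ab (letter_eval G y a) = Polynomial.monom 1 (snd a)"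
      using True Cons.prems by (simp add: letter_eval_def ab_y)
    ultimately show ?thesis using True Cons * by simp
  next
    case False
    then have "lookup (mon b * D (letter_eval G y a) i) c
        = (if (b - Polynomial.monom 1 (snd a), snd a) = (c, i) then - 1 else 0)"
      using Cons.prems by (auto simp: letter_eval_def D_hom y_closed ab_y D_y mon_mult lookup_single when_def)
    moreover have "ab (letter_eval G y a) = - Polynomial.monom 1 (snd a)"
      using False Cons.prems by (simp add: letter_eval_def ab_hom y_closed ab_y)
    ultimately show ?thesis using False Cons * by auto
  qed
qed (simp add: D_hom)

text \<open>Read a word as a path in the Cayley graph of the abelianization. For any transversal \<open>t\<close>,
  the word telescopes into the edge elements \<open>t a \<otimes> y i \<otimes> inv (t (a + x\<^sub>i))\<close>, which lie in the
  abelian derived subgroup, so only the signed edge counts, i.e. the Fox derivatives, matter.\<close>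

lemma fox_derivatives_faithful:
  assumes x: "x \<in> carrier G" and abx: "ab x = 0" and Dx: "\<And>j. D x j = 0"
  shows "x = \<one>"
proof -
  let ?N = "derived G (carrier G)"
  have N: "subgroup ?N G" by (rule derived_is_subgroup) simp
  have N_comm: "comm_group (G\<lparr>carrier := ?N\<rparr>)"
  proof (rule group.group_comm_groupI[OF subgroup_imp_group[OF N]])
    fix u v assume uv: "u \<in> carrier (G\<lparr>carrier := ?N\<rparr>)" "v \<in> carrier (G\<lparr>carrier := ?N\<rparr>)"
    then have c: "u \<in> carrier G" "v \<in> carrier G" using subgroup.mem_carrier[OF N] by auto
    have "u \<otimes> v \<otimes> inv u \<otimes> inv v \<in> derived_set G ?N" using uv by auto
    then have "u \<otimes> v \<otimes> inv u \<otimes> inv v \<in> derived G ?N" by (simp add: derived_def generate.incl)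
    then have "u \<otimes> v \<otimes> inv u \<otimes> inv v = \<one>" using metabelian by blast
    then have "u \<otimes> v \<otimes> inv u = v" using c by (metis inv_closed inv_equality inv_inv m_closed)
    then have "u \<otimes> v = v \<otimes> u" using c by (metis inv_closed inv_solve_right m_closed)
    then show "u \<otimes>\<^bsub>G\<lparr>carrier := ?N\<rparr>\<^esub> v = v \<otimes>\<^bsub>G\<lparr>carrier := ?N\<rparr>\<^esub> u" by simp
  qed
  define A where "A = ab ` carrier G"
  \<comment> \<open>The default \<open>\<one>\<close> keeps \<open>t a\<close> in the group even for
    \<open>a\<close> outside \<open>A\<close>, and \<open>t 0 = \<one>\<close> lets
    \<open>x = \<one>\<close> be read off at the end.\<close>
  define t where "t a = (if a \<in> A \<and> a \<noteq> 0 then SOME g. g \<in> carrier G \<and> ab g = a else \<one>)" for a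
  have t: "t a \<in> carrier G \<and> ab (t a) = a" if "a \<in> A" for a
  proof (cases "a = 0")
    case False
    then have "t a = (SOME g. g \<in> carrier G \<and> ab g = a)" using that by (simp add: t_def)
    moreover have "\<exists>g. g \<in> carrier G \<and> ab g = a" using that by (auto simp: A_def)
    ultimately show ?thesis using someI_ex[of "\<lambda>g. g \<in> carrier G \<and> ab g = a"] by simp
  qed (simp add: t_def ab_hom)
  have tc: "t a \<in> carrier G" for a using t by (cases "a \<in> A") (auto simp: t_def)
  define E where "E e = t (fst e) \<otimes> y (snd e) \<otimes> inv (t (fst e + Polynomial.monom 1 (snd e)))" for e
  have Ec: "E e \<in> carrier G" if "snd e < r" for e using that tc y_closed by (simp add: E_def)
  have A_step: "a + Polynomial.monom 1 i \<in> A" "a - Polynomial.monom 1 i \<in> A" if "a \<in> A" "i < r" for a i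
  proof -
    obtain g where "g \<in> carrier G" "a = ab g" using \<open>a \<in> A\<close> by (auto simp: A_def)
    then have "a + Polynomial.monom 1 i = ab (g \<otimes> y i)" "g \<otimes> y i \<in> carrier G"
      "a - Polynomial.monom 1 i = ab (g \<otimes> inv (y i))" "g \<otimes> inv (y i) \<in> carrier G"
      using y_closed ab_y that by (simp_all add: ab_hom)
    then show "a + Polynomial.monom 1 i \<in> A" "a - Polynomial.monom 1 i \<in> A"
      unfolding A_def by blast+
  qed
  have EN: "E (a, i) \<in> ?N" if "a \<in> A" "i < r" for a i
    using that A_step t y_closed by (intro ab_eq_0_imp_derived) (auto simp: E_def ab_hom ab_y)
  have edgesN: "E (snd e) \<in> ?N \<and> snd (snd e) < r"
    if "a \<in> A" "\<forall>a\<in>set w. snd a < r" "e \<in> set (edges a w)" for a w e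
    using that
  proof (induction w arbitrary: a)
    case (Cons l w)
    then have l: "a \<in> A" "snd l < r" and w: "\<forall>a\<in>set w. snd a < r" by auto
    note step = A_step[OF l]
    show ?case
      using Cons.prems(3) EN[OF l] EN[OF step(2) l(2)] Cons.IH[OF step(1) w] Cons.IH[OF step(2) w] l
      by (cases "fst l") auto
  qed simp
  have tele: "t a \<otimes> list_eval G y w = list_eval G E (edges a w) \<otimes> t (a + ab (list_eval G y w))"
    if "a \<in> A" "\<forall>a\<in>set w. snd a < r" for a w
    using that
  proof (induction w arbitrary: a)
    case Nil
    then show ?case using tc by (simp add: ab_hom)
  next
    case (Cons l w)
    define b where "b = a + ab (letter_eval G y l)"
    define e where "e = (if fst l then (True, (a, snd l)) else (False, (a - Polynomial.monom 1 (snd l), snd l)))"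
    have l: "snd l < r" "y (snd l) \<in> carrier G" using Cons.prems y_closed by auto
    have b: "b = (if fst l then a + Polynomial.monom 1 (snd l) else a - Polynomial.monom 1 (snd l))"
      using l by (simp add: b_def letter_eval_def ab_hom ab_y)
    have bA: "b \<in> A" using A_step[OF Cons.prems(1) l(1)] by (simp add: b)
    have e: "edges a (l # w) = e # edges b w" by (simp add: e_def b)
    have w: "list_eval G y w \<in> carrier G" using Cons.prems by (intro word_closed) auto
    have ev: "list_eval G E (edges b w) \<in> carrier G"
      using edgesN[OF bA] Cons.prems by (intro list_eval_closed Ec) auto
    have step: "t a \<otimes> letter_eval G y l = letter_eval G E e \<otimes> t b"
      using l tc by (auto simp: letter_eval_def e_def E_def b m_assoc inv_mult_group)
    have lc: "letter_eval G y l \<in> carrier G" "letter_eval G E e \<in> carrier G"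
      using l Ec by (auto simp: letter_eval_def e_def)
    have "t a \<otimes> list_eval G y (l # w) = (t a \<otimes> letter_eval G y l) \<otimes> list_eval G y w"
      using w lc tc by (simp add: m_assoc)
    also have "\<dots> = letter_eval G E e \<otimes> (t b \<otimes> list_eval G y w)"
      unfolding step using w lc tc by (simp add: m_assoc)
    also have "\<dots> = letter_eval G E e \<otimes> (list_eval G E (edges b w) \<otimes> t (b + ab (list_eval G y w)))"
      using Cons.IH[OF bA] Cons.prems by simp
    also have "b + ab (list_eval G y w) = a + ab (list_eval G y (l # w))"
      using w lc by (simp add: b_def ab_hom)
    finally show ?case unfolding e using lc ev tc by (simp add: m_assoc)
  qed
  obtain w where w: "\<forall>a\<in>set w. snd a < r" "x = list_eval G y w" using generated[OF x] by blast
  have A0: "0 \<in> A" unfolding A_def using ab_hom(2) by (metis image_eqI one_closed)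
  \<comment> \<open>All edge elements met lie in the derived subgroup, so the product can be
    evaluated in this commutative group.\<close>
  have "list_eval G E (edges 0 w) = list_eval (G\<lparr>carrier := ?N\<rparr>) E (edges 0 w)"
  proof -
    have "list_eval G E v = list_eval (G\<lparr>carrier := ?N\<rparr>) E v" if "\<forall>e\<in>set v. E (snd e) \<in> ?N" for v
      using that by (induction v) (auto simp: letter_eval_def m_inv_consistent[OF N])
    then show ?thesis using edgesN[OF A0 w(1)] by blast
  qed
  also have "\<dots> = \<one>\<^bsub>G\<lparr>carrier := ?N\<rparr>\<^esub>"
  proof (rule comm_group.list_eval_eq_one[OF N_comm])
    show "signed_count (edges 0 w) z = 0" for z
      using signed_count_edges[OF w(1), of 0 "fst z" "snd z"] Dx[of "snd z"] w(2) by simp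
  qed (use edgesN[OF A0 w(1)] in auto)
  finally have "list_eval G E (edges 0 w) = \<one>" by simp
  then have "t 0 \<otimes> x = t 0" using tele[OF A0 w(1)] abx w(2) tc by simp
  then show ?thesis using x by (simp add: t_def)
qed

sublocale fox_group G ab D
proof
  show "moment 0 (D x j) = of_int (Polynomial.coeff (ab x) j)" if "x \<in> carrier G" for x j
    using generated[OF that] moment_0_D_word by blast
qed (use additive_ab cocycle_D fox_derivatives_faithful ab_eq_0_imp_derived in blast)+

end

text \<open>By the universal property the \<open>i\<close>-th generator can be sent to
  \<open>monom 1 i\<close> paired with the \<open>i\<close>-th unit vector; the two components of
  this homomorphism are \<open>ab\<close> and \<open>D\<close>.\<close>

lemma free_metabelian_fox_generated:
  obtains ab D where "fox_generated (free_metabelian r) r (generator r) ab D"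
proof -
  interpret M: group "free_metabelian r" by (rule group_free_metabelian)
  obtain f where f: "f \<in> hom (free_metabelian r) magnus_group"
    "\<And>i. i < r \<Longrightarrow> f (generator r i) = (Polynomial.monom 1 i, \<lambda>j. if j = i then 1 else 0)"
    using free_metabelian_universal[OF group_magnus_group magnus_group_metabelian,
        of r "\<lambda>i. (Polynomial.monom 1 i, \<lambda>j. if j = i then 1 else 0)"]
    by (auto simp: magnus_group_simps)
  have mult: "f (x \<otimes>\<^bsub>free_metabelian r\<^esub> y) = (fst (f x) + fst (f y), \<lambda>j. snd (f x) j + mon (fst (f x)) * snd (f y) j)"
    if "x \<in> carrier (free_metabelian r)" "y \<in> carrier (free_metabelian r)" for x y
    using hom_mult[OF f(1) that] by (simp add: magnus_group_simps)
  have "fox_generated (free_metabelian r) r (generator r) (\<lambda>x. fst (f x)) (\<lambda>x. snd (f x))"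
  proof (intro fox_generated.intro fox_generated_axioms.intro M.is_group)
    show "M.additive (\<lambda>x. fst (f x))" by (simp add: M.additive_def mult)
    show "M.cocycle (\<lambda>x. fst (f x)) (carrier (free_metabelian r)) (\<lambda>x. snd (f x) j)" for j
      by (simp add: M.cocycle_def mult)
    show "\<exists>w. (\<forall>a\<in>set w. snd a < r) \<and> x = list_eval (free_metabelian r) (generator r) w"
      if "x \<in> carrier (free_metabelian r)" for x
      using free_metabelian_elem[OF that] by blast
  qed (simp_all only: generator_closed free_metabelian_second_derived subset_refl f(2) fst_conv snd_conv)
  then show ?thesis by (rule that)
qed

section \<open>Generators modulo the derived subgroup\<close>

fun word_of_list :: "(bool \<times> nat) list \<Rightarrow> gword" where
  "word_of_list [] = GOne"
| "word_of_list (a # w) = GMul (if fst a then GVar (snd a) else GInv (GVar (snd a))) (word_of_list w)"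

lemma word_eval_word_of_list: "word_eval G x (word_of_list w) = list_eval G x w"
  by (induction w) (auto simp: letter_eval_def)

lemma gvars_word_of_list: "gvars (word_of_list w) = snd ` set w"
  by (induction w) auto

text \<open>Words for the \<open>k i\<close> form a system in \<open>r\<close> unknowns that the
  free generators solve. A solution in \<open>H\<close> defines, by freeness, an endomorphism into
  \<open>H\<close> fixing every \<open>k i\<close>.\<close>

lemma verbally_closed_fixing_hom:
  assumes H: "subgroup H (free_metabelian r)" and closed: "l_verbally_closed l (free_metabelian r) H"
    and k: "\<And>i. i < l \<Longrightarrow> k i \<in> H"
  shows "\<exists>f\<in>hom (free_metabelian r) (free_metabelian r).
    f ` carrier (free_metabelian r) \<subseteq> H \<and> (\<forall>i<l. f (k i) = k i)"
proof -
  let ?M = "free_metabelian r"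
  interpret M: group ?M by (rule group_free_metabelian)
  have "\<forall>i\<in>{..<l}. \<exists>w. (\<forall>a\<in>set w. snd a < r) \<and> k i = list_eval ?M (generator r) w"
    using k subgroup.mem_carrier[OF H] free_metabelian_elem by (metis lessThan_iff)
  then obtain w where "\<forall>i\<in>{..<l}. (\<forall>a\<in>set (w i). snd a < r) \<and> k i = list_eval ?M (generator r) (w i)"
    by (rule bchoice[THEN exE])
  then have w: "\<And>i a. i < l \<Longrightarrow> a \<in> set (w i) \<Longrightarrow> snd a < r"
    "\<And>i. i < l \<Longrightarrow> k i = list_eval ?M (generator r) (w i)" by auto
  have "\<forall>i<l. gvars (word_of_list (w i)) \<subseteq> {..<r} \<and> k i \<in> H"
    using w(1) k by (auto simp: gvars_word_of_list)
  moreover have "generator r ` {..<r} \<subseteq> carrier ?M"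
    using generator_closed by auto
  moreover have "\<forall>i<l. word_eval ?M (generator r) (word_of_list (w i)) = k i"
    using w(2) by (simp add: word_eval_word_of_list)
  ultimately obtain x where x: "x ` {..<r} \<subseteq> H"
    "\<And>i. i < l \<Longrightarrow> word_eval ?M x (word_of_list (w i)) = k i"
    using closed[unfolded l_verbally_closed_def, rule_format, of "\<lambda>i. word_of_list (w i)" r k] by blast
  have xc: "x i \<in> carrier ?M" if "i < r" for i
    using x(1) that subgroup.mem_carrier[OF H] by blast
  have "\<exists>f\<in>hom ?M ?M. \<forall>i<r. f (generator r i) = x i"
    using xc by (rule free_metabelian_universal[OF group_free_metabelian
          equalityD1[OF free_metabelian_second_derived]]) auto
  then obtain f where f: "f \<in> hom ?M ?M" "\<And>i. i < r \<Longrightarrow> f (generator r i) = x i" by blast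
  interpret f: group_hom ?M ?M f using f(1) by unfold_locales
  have fw: "f (list_eval ?M (generator r) v) = list_eval ?M x v" if "\<forall>a\<in>set v. snd a < r" for v
  proof -
    have "f (list_eval ?M (generator r) v) = list_eval ?M (\<lambda>i. f (generator r i)) v"
      using that by (intro f.hom_list_eval) (auto simp: generator_closed)
    also have "\<dots> = list_eval ?M x v" using that f(2) by (intro list_eval_cong) auto
    finally show ?thesis .
  qed
  have "f g \<in> H" if g: "g \<in> carrier ?M" for g
  proof -
    obtain v where v: "\<forall>a\<in>set v. snd a < r" "g = list_eval ?M (generator r) v"
      using free_metabelian_elem[OF g] by blast
    then show ?thesis using fw[OF v(1)] x(1) M.list_eval_in_subgroup[OF H, of v x] by auto
  qed
  moreover have "f (k i) = k i" if "i < l" for i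
    using fw[of "w i"] w[OF that] w(2)[OF that] x(2)[OF that] by (simp add: word_eval_word_of_list)
  ultimately show ?thesis using f(1) by blast
qed

section \<open>Minimal generating tuples of a subgroup modulo the derived subgroup\<close>

context fox_group
begin

definition ab_generating_tuple :: "'a set \<Rightarrow> nat \<Rightarrow> (nat \<Rightarrow> 'a) \<Rightarrow> bool" where
  "ab_generating_tuple H n h \<longleftrightarrow>
     (\<forall>i<n. h i \<in> H) \<and> (\<forall>x\<in>H. ab x \<in> lspan (\<lambda>i. ab (h i)) n)"

abbreviation (input) "abelianization \<equiv> G Mod derived G (carrier G)"
abbreviation (input) "ab_class x \<equiv> derived G (carrier G) #> x"

lemma proj_group_hom: "group_hom G abelianization (\<lambda>x. ab_class x)"
  using normal.r_coset_hom_Mod[OF derived_self_is_normal] derived_quot_is_group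
  by (intro group_hom.intro group_hom_axioms.intro is_group)

text \<open>Identifies the abelianization with the image of \<open>ab\<close>, which translates
  \<open>r_ab\<close> into statements about \<open>lspan\<close>.\<close>

lemma proj_eq_iff:
  assumes "x \<in> carrier G" "y \<in> carrier G"
  shows "ab_class x = ab_class y \<longleftrightarrow> ab x = ab y"
proof -
  interpret N: normal "derived G (carrier G)" G by (rule derived_self_is_normal)
  have "ab_class x = ab_class y \<longleftrightarrow> x \<otimes> inv y \<in> derived G (carrier G)"
  proof
    assume "ab_class x = ab_class y"
    then have "x \<in> ab_class y" using rcos_self[OF assms(1) N.subgroup_axioms] by simp
    then obtain d where "d \<in> derived G (carrier G)" "x = d \<otimes> y" by (auto simp: r_coset_def)
    then show "x \<otimes> inv y \<in> derived G (carrier G)"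
      using assms N.mem_carrier by (simp add: m_assoc)
  next
    assume "x \<otimes> inv y \<in> derived G (carrier G)"
    moreover have "x = (x \<otimes> inv y) \<otimes> y" using assms by (simp add: m_assoc)
    ultimately have "x \<in> ab_class y" by (auto simp: r_coset_def)
    then show "ab_class x = ab_class y" using repr_independence[OF _ assms(2) N.subgroup_axioms] by simp
  qed
  also have "\<dots> \<longleftrightarrow> ab (x \<otimes> inv y) = 0"
    using assms ab_kernel[of "x \<otimes> inv y"] additive_derived[OF ab subset_refl, of "x \<otimes> inv y"]
    by (intro iffI) simp_all
  finally show ?thesis using assms by (simp add: ab_mult ab_inv)
qed

text \<open>A generating tuple shows that the \<open>LEAST\<close> in \<open>r_ab\<close> ranges
  over a nonempty set, so the minimum is attained as well as bounded by \<open>n\<close>.\<close>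

lemma r_ab_le:
  assumes H: "subgroup H G" and h: "ab_generating_tuple H n h"
  shows "r_ab G H \<le> n \<and> (\<exists>S. finite S \<and> card S = r_ab G H \<and> S \<subseteq> carrier abelianization \<and>
    generate abelianization S = (\<lambda>x. ab_class x) ` H)"
proof -
  interpret P: group_hom G abelianization "\<lambda>x. ab_class x" by (rule proj_group_hom)
  define gen where "gen k \<longleftrightarrow> (\<exists>S. finite S \<and> card S = k \<and> S \<subseteq> carrier abelianization \<and>
    generate abelianization S = (\<lambda>x. ab_class x) ` H)" for k
  have r: "r_ab G H = (LEAST k. gen k)" by (simp add: r_ab_def gen_def Let_def)
  have hH: "h ` {..<n} \<subseteq> H" using h by (auto simp: ab_generating_tuple_def)
  then have hc: "h ` {..<n} \<subseteq> carrier G" using subgroup.subset[OF H] by blast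
  have "generate abelianization ((\<lambda>x. ab_class x) ` h ` {..<n}) = (\<lambda>x. ab_class x) ` generate G (h ` {..<n})"
    by (rule P.generate_img[OF hc])
  also have "\<dots> = (\<lambda>x. ab_class x) ` H"
  proof
    show "(\<lambda>x. ab_class x) ` generate G (h ` {..<n}) \<subseteq> (\<lambda>x. ab_class x) ` H"
      using generate_subgroup_incl[OF hH H] by (rule image_mono)
    show "(\<lambda>x. ab_class x) ` H \<subseteq> (\<lambda>x. ab_class x) ` generate G (h ` {..<n})"
    proof (rule image_subsetI)
      fix x assume x: "x \<in> H"
      then obtain c :: "nat \<Rightarrow> int" where "ab x = (\<Sum>i<n. of_int (c i) * ab (h i))"
        using h by (auto simp: ab_generating_tuple_def lspan_def)
      then obtain g where g: "g \<in> generate G (h ` {..<n})" "ab g = ab x"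
        using generate_lin_comb[OF hc, of c] ab by auto
      then have "ab_class x = ab_class g"
        using proj_eq_iff x g(2) subgroup.mem_carrier[OF H] generate_in_carrier[OF hc g(1)] by metis
      then show "ab_class x \<in> (\<lambda>x. ab_class x) ` generate G (h ` {..<n})" using g(1) by blast
    qed
  qed
  finally have "gen (card ((\<lambda>x. ab_class x) ` h ` {..<n}))"
    unfolding gen_def using hc P.hom_closed by (intro exI[of _ "(\<lambda>x. ab_class x) ` h ` {..<n}"]) auto
  moreover have "card ((\<lambda>x. ab_class x) ` h ` {..<n}) \<le> n"
    by (metis card_image_le card_lessThan finite_imageI finite_lessThan order_trans)
  ultimately show ?thesis
    unfolding r gen_def[symmetric] by (meson LeastI Least_le order_trans)
qed

text \<open>A generating set of minimal size in the quotient is lifted to \<open>H\<close>. An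
  integral relation among the lifts would, by \<open>lspan_reduce\<close>, yield a generating tuple
  with one element fewer.\<close>

lemma independent_ab_generating_tuple:
  assumes H: "fin_gen_subgroup G H"
  obtains h where "ab_generating_tuple H (r_ab G H) h" "lindep (\<lambda>i. ab (h i)) (r_ab G H)"
proof -
  interpret P: group_hom G abelianization "\<lambda>x. ab_class x" by (rule proj_group_hom)
  have sub: "subgroup H G" using H by (simp add: fin_gen_subgroup_def)
  obtain S where S: "finite S" "S \<subseteq> carrier G" "generate G S = H"
    using H by (auto simp: fin_gen_subgroup_def)
  obtain g and n :: nat where g: "S = g ` {..<n}"
    using finite_imp_nat_seg_image_inj_on[OF S(1)] by (auto simp: lessThan_def)
  have tuple_g: "ab_generating_tuple H n g"
    unfolding ab_generating_tuple_def
  proof (intro conjI allI impI ballI)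
    show "g i \<in> H" if "i < n" for i using that S(3) g by (auto intro: generate.incl)
    show "ab x \<in> lspan (\<lambda>i. ab (g i)) n" if "x \<in> H" for x
    proof (rule additive_generate[OF S(2) _ ab])
      show "x \<in> generate G S" using that S(3) by simp
      show "ab s \<in> lspan (\<lambda>i. ab (g i)) n" if "s \<in> S" for s
        using that g lspan_base[of _ n "\<lambda>i. ab (g i)"] by auto
    qed
  qed
  obtain T where T: "finite T" "card T = r_ab G H" "T \<subseteq> carrier abelianization"
    "generate abelianization T = (\<lambda>x. ab_class x) ` H"
    using conjunct2[OF r_ab_le[OF sub tuple_g]] by (elim exE conjE) (rule that)
  define m where "m = r_ab G H"
  obtain e where e: "bij_betw e {..<m} T"
    using ex_bij_betw_nat_finite[OF T(1)] T(2) by (auto simp: m_def atLeast0LessThan)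
  have "\<forall>i\<in>{..<m}. \<exists>x. x \<in> H \<and> e i = ab_class x"
  proof
    fix i assume "i \<in> {..<m}"
    then have "e i \<in> generate abelianization T" using e by (auto simp: bij_betw_def intro: generate.incl)
    then show "\<exists>x. x \<in> H \<and> e i = ab_class x" using T(4) by auto
  qed
  then obtain h where "\<forall>i\<in>{..<m}. h i \<in> H \<and> e i = ab_class (h i)" by (rule bchoice[THEN exE])
  then have h: "\<And>i. i < m \<Longrightarrow> h i \<in> H" "\<And>i. i < m \<Longrightarrow> e i = ab_class (h i)" by auto
  have hc: "h ` {..<m} \<subseteq> carrier G" and hH: "h ` {..<m} \<subseteq> H"
    using h(1) subgroup.mem_carrier[OF sub] by auto
  have "T = e ` {..<m}" using e by (simp add: bij_betw_def)
  also have "\<dots> = (\<lambda>x. ab_class x) ` h ` {..<m}" using h(2) by (simp add: image_image)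
  finally have T_eq: "(\<lambda>x. ab_class x) ` H = (\<lambda>x. ab_class x) ` generate G (h ` {..<m})"
    using T(4) P.generate_img[OF hc] by simp
  have tuple: "ab_generating_tuple H m h"
    unfolding ab_generating_tuple_def
  proof (intro conjI allI impI ballI)
    fix x assume x: "x \<in> H"
    then obtain z where z: "z \<in> generate G (h ` {..<m})" "ab_class x = ab_class z"
      using T_eq by blast
    then have "ab x = ab z"
      using proj_eq_iff x subgroup.mem_carrier[OF sub] generate_in_carrier[OF hc] by blast
    moreover have "ab z \<in> lspan (\<lambda>i. ab (h i)) m"
      using lspan_base[of _ m "\<lambda>i. ab (h i)"] by (intro additive_generate[OF hc z(1) ab]) auto
    ultimately show "ab x \<in> lspan (\<lambda>i. ab (h i)) m" by simp
  qed (rule h(1))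
  have "lindep (\<lambda>i. ab (h i)) m"
  proof (rule ccontr)
    assume "\<not> lindep (\<lambda>i. ab (h i)) m"
    then obtain c :: "nat \<Rightarrow> int" where c: "(\<Sum>i<m. of_int (c i) * ab (h i)) = 0" "\<exists>i<m. c i \<noteq> 0"
      by (auto simp: lindep_def)
    then have "m > 0" by auto
    obtain b where b: "\<And>i. i < m - 1 \<Longrightarrow> b i \<in> lspan (\<lambda>i. ab (h i)) m"
      "\<And>i. i < m \<Longrightarrow> ab (h i) \<in> lspan b (m - 1)"
      using lspan_reduce[OF c] by blast
    have "\<forall>i\<in>{..<m - 1}. \<exists>x. x \<in> H \<and> ab x = b i"
    proof
      fix i assume "i \<in> {..<m - 1}"
      then obtain d :: "nat \<Rightarrow> int" where "b i = (\<Sum>i<m. of_int (d i) * ab (h i))"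
        using b(1)[of i] by (auto simp: lspan_def)
      then show "\<exists>x. x \<in> H \<and> ab x = b i"
        using generate_lin_comb[OF hc, of d] generate_subgroup_incl[OF hH sub] ab by auto
    qed
    then obtain h' where "\<forall>i\<in>{..<m - 1}. h' i \<in> H \<and> ab (h' i) = b i" by (rule bchoice[THEN exE])
    then have h': "\<And>i. i < m - 1 \<Longrightarrow> h' i \<in> H" "\<And>i. i < m - 1 \<Longrightarrow> ab (h' i) = b i" by auto
    have "lspan b (m - 1) = lspan (\<lambda>i. ab (h' i)) (m - 1)"
      unfolding lspan_def using h'(2) by (auto intro!: sum.cong)
    then have "ab_generating_tuple H (m - 1) h'"
      using tuple h'(1) b(2) lspan_trans[of _ "\<lambda>i. ab (h i)" m "\<lambda>i. ab (h' i)" "m - 1"]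
      by (auto simp: ab_generating_tuple_def)
    then have "r_ab G H \<le> m - 1" using r_ab_le[OF sub] by blast
    then show False using \<open>m > 0\<close> by (simp add: m_def)
  qed
  then show ?thesis using tuple that by (simp add: m_def)
qed

end

theorem theorem4:
  fixes r l :: nat and H :: "(bool \<times> nat) list set set"
  assumes "r \<ge> 1" and "l \<ge> 1"
    and "fin_gen_subgroup (free_metabelian r) H"
    and "l_verbally_closed l (free_metabelian r) H"
    and "r_ab (free_metabelian r) H = l + 1"
  shows "is_retract (free_metabelian r) H"
proof -
  obtain ab D where "fox_generated (free_metabelian r) r (generator r) ab D"
    by (rule free_metabelian_fox_generated)
  then interpret fox_generated "free_metabelian r" r "generator r" ab D .
  have H: "subgroup H (free_metabelian r)" using assms(3) by (simp add: fin_gen_subgroup_def)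
  \<comment> \<open>The rank hypothesis supplies \<open>Suc l\<close> elements of \<open>H\<close>
    that are independent and generating modulo the derived subgroup.\<close>
  obtain h where h: "ab_generating_tuple H (Suc l) h" "lindep (\<lambda>i. ab (h i)) (Suc l)"
    using independent_ab_generating_tuple[OF assms(3)] assms(5) by auto
  show ?thesis
  proof (rule is_retract_of_fixing_homs[OF H assms(2) _ _ _ h(2)])
    show "\<exists>f\<in>hom (free_metabelian r) (free_metabelian r).
        f ` carrier (free_metabelian r) \<subseteq> H \<and> (\<forall>i<l. f (k i) = k i)"
      if "\<And>i. i < l \<Longrightarrow> k i \<in> H" for k
      by (rule verbally_closed_fixing_hom[OF H assms(4) that])
  qed (use h(1) in \<open>auto simp: ab_generating_tuple_def\<close>)
qed

end
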